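(* Let $p=r$ be a positive even integer, and suppose that the $p$-order feasibility problem $(\mathbf{F}_p)$ with data $F\in\mathbb{Z}^{m\times n}$, $G,H\in\mathbb{Z}^m$ of bit size at most $\tau$ is feasible. Then there exists a feasible solution $(x,z)$ of $(\mathbf{F}_p)$ such that $\|(x,z)\|_2\le R$, where $\log R=\tau(\min\{m,n\}\,r)^{O(n)}$.
   Context: For rational $p>1$, the $p$-order cone is $\mathcal{K}_p^n:=\{(x,z)\in\mathbb{R}^{n}\times\mathbb{R}: \|x\|_p\le z\}$, where $\|x\|_p=(\sum_{i=1}^n|x_i|^p)^{1/p}$. Given $F\in\mathbb{Z}^{m\times n}$, $G,H\in\mathbb{Z}^m$ ($m\ge 1$), a feasible solution of the $p$-order feasibility problem $(\mathbf{F}_p)$ is a vector $(x,z)\in\mathbb{R}^{n+1}$ with $Fx+Gz\le H$ (componentwise) and $(x,z)\in\mathcal{K}_p^n$; the problem is feasible if such a vector exists. Standing assumption: $n\ge2$. $\tau$ denotes the maximum bit size of the entries of $F,G,H$; the bit size of an integer $b\neq0$ is $\lfloor\log_2|b|\rfloor+1$, and that of $0$ is $1$. $R$ depends only on $p,n,m,\tau$. For $g,h:\mathbb{N}^l\to\mathbb{R}_{>0}$, $g(v)=O(h(v))$ means that there are $b,N\in\mathbb{N}$ with $g(v)\le b\,h(v)$ whenever all coordinates of $v$ are at least $N$; an $O(\cdot)$ inside an exponent stands for some function of that class. *)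

theory Defs
  imports Complex_Main "HOL-Library.Landau_Symbols" "Jordan_Normal_Form.Matrix"
begin

definition p_norm :: "real \<Rightarrow> real vec \<Rightarrow> real" where
  "p_norm p x = (\<Sum>i<dim_vec x. \<bar>x $ i\<bar> powr p) powr (1 / p)"

definition p_cone :: "real \<Rightarrow> nat \<Rightarrow> (real vec \<times> real) set" where
  "p_cone p n = {(x, z). x \<in> carrier_vec n \<and> p_norm p x \<le> z}"

(* The order on vectors from Jordan_Normal_Form is componentwise; the data are integral and are
   cast to the reals entrywise. *)
definition feasible_solution ::
  "real \<Rightarrow> nat \<Rightarrow> int mat \<Rightarrow> int vec \<Rightarrow> int vec \<Rightarrow> real vec \<times> real \<Rightarrow> bool" where
  "feasible_solution p n F G H = (\<lambda>(x, z).
     (x, z) \<in> p_cone p n \<and>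
     map_mat real_of_int F *\<^sub>v x + z \<cdot>\<^sub>v map_vec real_of_int G \<le> map_vec real_of_int H)"

definition feasible :: "real \<Rightarrow> nat \<Rightarrow> int mat \<Rightarrow> int vec \<Rightarrow> int vec \<Rightarrow> bool" where
  "feasible p n F G H \<longleftrightarrow> (\<exists>v. feasible_solution p n F G H v)"

definition bit_size :: "int \<Rightarrow> nat" where
  "bit_size b = (if b = 0 then 1 else nat \<lfloor>log 2 \<bar>real_of_int b\<bar>\<rfloor> + 1)"

definition bit_size_le :: "nat \<Rightarrow> int mat \<Rightarrow> int vec \<Rightarrow> int vec \<Rightarrow> bool" where
  "bit_size_le \<tau> F G H \<longleftrightarrow>
     (\<forall>a \<in> elements_mat F. bit_size a \<le> \<tau>) \<and>
     (\<forall>i < dim_vec G. bit_size (G $ i) \<le> \<tau>) \<and>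
     (\<forall>i < dim_vec H. bit_size (H $ i) \<le> \<tau>)"

end

theory Submission
  imports Defs "Jordan_Normal_Form.Char_Poly" "HOL-Library.FuncSet" "HOL-Analysis.Convex"
begin

text \<open>Take a feasible point whose set of tight linear constraints is maximal. By convexity of the cone,
  every cone point satisfying these constraints with equality is feasible as well, so it suffices to find
  a small one among the latter. With \<open>z = u\<^sup>2\<close> and a slack \<open>s\<close>, they are the zeros of
  a single nonnegative integer polynomial \<open>Q\<close> in the \<open>N = n + 2\<close> variables
  \<open>(x, u, s)\<close>, of degree at most \<open>4 r\<close>.

  To bound a zero of \<open>Q\<close>, minimise \<open>Q y + (\<Sum>i. y i ^ (E + 1)) / ((E + 1) \<delta>)\<close> with
  \<open>E = 4 r + 1\<close>. The minimisers stay bounded as \<open>\<delta>\<close> tends to infinity and accumulate at a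
  zero of \<open>Q\<close>. They satisfy \<open>y j ^ E = - \<delta> * \<partial>\<^sub>j Q y\<close>, which rewrites every monomial into a
  combination of the \<open>E ^ N\<close> monomials with all exponents below \<open>E\<close>. Multiplication by
  \<open>y j\<close> thus becomes a matrix over \<open>\<int>[\<delta>]\<close>, whose characteristic polynomial vanishes at \<open>y j\<close>;
  its leading part in \<open>\<delta>\<close> is a nonzero integer polynomial that vanishes at the limit of \<open>y j\<close>,
  and the size of its coefficients bounds that limit.\<close>

section \<open>Coefficient sums of polynomials and characteristic polynomials\<close>

text \<open>Subadditivity and submultiplicativity suffice to bound a determinant through the Leibniz
  formula. The locale serves for the integers, for integer polynomials, and for polynomials over
  these.\<close>

locale ring_seminorm =
  fixes \<nu> :: "'a::comm_ring_1 \<Rightarrow> real"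
  assumes zero: "\<nu> 0 = 0"
    and one: "\<nu> 1 \<le> 1"
    and minus: "\<nu> (- a) = \<nu> a"
    and add: "\<nu> (a + b) \<le> \<nu> a + \<nu> b"
    and mult: "\<nu> (a * b) \<le> \<nu> a * \<nu> b"
    and nonneg: "0 \<le> \<nu> a"
begin

lemma sum_le: "\<nu> (sum f A) \<le> (\<Sum>i\<in>A. \<nu> (f i))"
proof (induction A rule: infinite_finite_induct)
  case (insert x F)
  then show ?case using add[of "f x" "sum f F"] by simp
qed (simp_all add: zero)

lemma prod_le: "\<nu> (prod f A) \<le> (\<Prod>i\<in>A. \<nu> (f i))"
proof (induction A rule: infinite_finite_induct)
  case (insert x F)
  have "\<nu> (prod f (insert x F)) \<le> \<nu> (f x) * \<nu> (prod f F)"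
    using insert mult by simp
  also have "\<dots> \<le> \<nu> (f x) * (\<Prod>i\<in>F. \<nu> (f i))"
    by (intro mult_left_mono insert nonneg)
  finally show ?case using insert by simp
qed (simp_all add: one)

text \<open>The Leibniz formula has \<open>fact n\<close> signed products of \<open>n\<close>
  entries each.\<close>

lemma det_le:
  assumes A: "A \<in> carrier_mat n n"
    and b: "\<And>i j. i < n \<Longrightarrow> j < n \<Longrightarrow> \<nu> (A $$ (i, j)) \<le> b"
  shows "\<nu> (det A) \<le> fact n * b ^ n"
proof -
  have "\<nu> (det A) \<le> (\<Sum>p | p permutes {0..<n}. \<nu> (signof p * (\<Prod>i = 0..<n. A $$ (i, p i))))"
    unfolding det_def'[OF A] by (rule sum_le)
  also have "\<dots> \<le> (\<Sum>p | p permutes {0..<n}. b ^ n)"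
  proof (rule sum_mono)
    fix p assume "p \<in> {p. p permutes {0..<n}}"
    then have p: "p i < n" if "i < n" for i
      using that permutes_in_image by fastforce
    have "\<nu> (signof p) \<le> 1"
      using one minus[of 1] by (simp add: sign_def)
    then have "\<nu> (signof p * (\<Prod>i = 0..<n. A $$ (i, p i))) \<le> 1 * \<nu> (\<Prod>i = 0..<n. A $$ (i, p i))"
      by (rule order_trans[OF mult mult_right_mono[OF _ nonneg]])
    also have "\<dots> \<le> (\<Prod>i = 0..<n. \<nu> (A $$ (i, p i)))" using prod_le by simp
    also have "\<dots> \<le> (\<Prod>i = 0..<n. b)"
      by (rule prod_mono) (auto simp: nonneg b p)
    finally show "\<nu> (signof p * (\<Prod>i = 0..<n. A $$ (i, p i))) \<le> b ^ n" by simp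
  qed
  also have "\<dots> = fact n * b ^ n" by (simp add: card_permutations[OF refl])
  finally show ?thesis .
qed

end

text \<open>The coefficient size \<open>\<nu>\<close> is a parameter so that the construction can be
  iterated: \<open>poly_l1 int_poly_l1\<close> measures characteristic polynomials of matrices whose
  entries are polynomials in \<delta>.\<close>

definition poly_l1 :: "('a::zero \<Rightarrow> real) \<Rightarrow> 'a poly \<Rightarrow> real" where
  "poly_l1 \<nu> p = (\<Sum>a\<leftarrow>coeffs p. \<nu> a)"

lemma poly_l1_0 [simp]: "poly_l1 \<nu> 0 = 0"
  by (simp add: poly_l1_def)

lemma poly_l1_pCons [simp]: "\<nu> 0 = 0 \<Longrightarrow> poly_l1 \<nu> (pCons a p) = \<nu> a + poly_l1 \<nu> p"
  by (simp add: poly_l1_def cCons_def)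

lemma poly_l1_eq_sum: "poly_l1 \<nu> p = (\<Sum>i\<le>degree p. \<nu> (coeff p i))" if "\<nu> 0 = 0"
proof (cases "p = 0")
  case False
  then show ?thesis
    by (simp add: poly_l1_def coeffs_def o_def interv_sum_list_conv_sum_set_nat atLeast0LessThan
        lessThan_Suc_atMost del: upt_Suc)
qed (simp add: that)

context ring_seminorm
begin

lemma poly_l1_nonneg: "0 \<le> poly_l1 \<nu> p"
  by (induction p) (simp_all add: zero nonneg)

lemma poly_l1_smult: "poly_l1 \<nu> (smult a p) \<le> \<nu> a * poly_l1 \<nu> p"
proof (induction p)
  case (pCons b p)
  then show ?case using mult[of a b] by (simp add: zero algebra_simps)
qed simp

lemma poly_l1_add: "poly_l1 \<nu> (p + q) \<le> poly_l1 \<nu> p + poly_l1 \<nu> q"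
proof (induction p q rule: poly_induct2)
  case (pCons a p b q)
  then show ?case using add[of a b] by (simp add: zero)
qed simp

lemma poly_l1_mult: "poly_l1 \<nu> (p * q) \<le> poly_l1 \<nu> p * poly_l1 \<nu> q"
proof (induction p)
  case (pCons a p)
  have "poly_l1 \<nu> (pCons a p * q) \<le> poly_l1 \<nu> (smult a q) + poly_l1 \<nu> (pCons 0 (p * q))"
    by (simp add: poly_l1_add mult_pCons_left)
  also have "\<dots> \<le> \<nu> a * poly_l1 \<nu> q + poly_l1 \<nu> p * poly_l1 \<nu> q"
    using pCons poly_l1_smult[of a q] by (simp add: zero)
  finally show ?case by (simp add: zero algebra_simps)
qed simp

lemma ring_seminorm_poly_l1: "ring_seminorm (poly_l1 \<nu>)"
proof
  show "poly_l1 \<nu> (- p) = poly_l1 \<nu> p" for p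
    by (induction p) (simp_all add: zero minus)
qed (simp_all add: poly_l1_nonneg poly_l1_mult poly_l1_add one zero one_pCons)

text \<open>The determinant bound is applied in the polynomial ring; the variable on the diagonal
  adds at most 1 to the size of an entry.\<close>

lemma char_poly_l1_le:
  assumes A: "A \<in> carrier_mat n n"
    and b: "\<And>i j. i < n \<Longrightarrow> j < n \<Longrightarrow> \<nu> (A $$ (i, j)) \<le> b"
  shows "poly_l1 \<nu> (char_poly A) \<le> fact n * (1 + b) ^ n"
proof -
  interpret P: ring_seminorm "poly_l1 \<nu>" by (rule ring_seminorm_poly_l1)
  show ?thesis unfolding char_poly_def
  proof (rule P.det_le)
    fix i j assume ij: "i < n" "j < n"
    have "char_poly_matrix A $$ (i, j) = (if i = j then [:0, 1:] else 0) + [: - A $$ (i, j) :]"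
      using A ij by (auto simp: char_poly_matrix_def)
    also have "poly_l1 \<nu> \<dots> \<le> poly_l1 \<nu> (if i = j then [:0, 1:] else 0) + poly_l1 \<nu> [: - A $$ (i, j) :]"
      by (rule poly_l1_add)
    also have "\<dots> \<le> 1 + b"
      using b[OF ij] one by (cases "i = j") (simp_all add: zero minus)
    finally show "poly_l1 \<nu> (char_poly_matrix A $$ (i, j)) \<le> 1 + b" .
  qed (use A in simp)
qed

end

interpretation int_abs: ring_seminorm "\<lambda>a::int. \<bar>real_of_int a\<bar>"
  by standard (simp_all add: abs_mult)

abbreviation int_poly_l1 :: "int poly \<Rightarrow> real" where
  "int_poly_l1 \<equiv> poly_l1 (\<lambda>a. \<bar>real_of_int a\<bar>)"

interpretation int_poly_l1: ring_seminorm int_poly_l1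
  by (rule int_abs.ring_seminorm_poly_l1)

section \<open>Real roots of integer polynomials, and limits of roots as a parameter grows\<close>

lemma poly_eq_sum_le:
  fixes p :: "'a::comm_semiring_1 poly"
  assumes "degree p \<le> n"
  shows "poly p x = (\<Sum>i\<le>n. coeff p i * x ^ i)"
  unfolding poly_altdef
  by (rule sum.mono_neutral_left) (use assms in \<open>auto simp: coeff_eq_0\<close>)

text \<open>It serves both to specialise the parameter \<delta> in matrix entries and to evaluate
  the final integer polynomial at a real number.\<close>

definition ev :: "real \<Rightarrow> int poly \<Rightarrow> real" where
  "ev \<delta> p = poly (map_poly of_int p) \<delta>"

interpretation ev: comm_ring_hom "ev \<delta>"
  by standard (simp_all add: ev_def hom_distribs)

lemma ev_0 [simp]: "ev \<delta> 0 = 0"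
  by (simp add: ev_def)

lemma ev_pCons: "ev \<delta> (pCons a p) = of_int a + \<delta> * ev \<delta> p"
  by (cases "a = 0 \<and> p = 0") (auto simp: ev_def map_poly_pCons)

text \<open>A Cauchy-type root bound: a nonzero integer leading coefficient has absolute value at
  least 1, so beyond the coefficient sum the leading term dominates all others.\<close>

lemma abs_root_le:
  fixes p :: "int poly"
  assumes "p \<noteq> 0" and root: "ev t p = 0"
  shows "\<bar>t\<bar> \<le> int_poly_l1 p"
proof (rule ccontr)
  assume gt: "\<not> ?thesis"
  define d where "d = degree p"
  have l1: "int_poly_l1 p = (\<Sum>i\<le>d. \<bar>real_of_int (coeff p i)\<bar>)"
    unfolding d_def by (rule poly_l1_eq_sum) simp
  have lead: "1 \<le> \<bar>real_of_int (coeff p d)\<bar>"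
    using assms(1) unfolding d_def by (simp flip: of_int_abs leading_coeff_0_iff)
  then have "1 \<le> int_poly_l1 p"
    unfolding l1 by (subst sum.remove[of _ d]) (auto intro!: add_increasing2 sum_nonneg)
  then have t: "1 < \<bar>t\<bar>" using gt by simp
  have e: "ev t p = (\<Sum>i\<le>d. of_int (coeff p i) * t ^ i)"
    unfolding ev_def d_def by (simp add: poly_altdef)
  \<comment> \<open>A nonzero constant has no root; this also makes the subtraction in
    \<open>d - 1\<close> genuine.\<close>
  have d0: "d \<noteq> 0"
  proof
    assume "d = 0"
    then show False using root lead unfolding e by simp
  qed
  have "(\<Sum>i\<le>d. of_int (coeff p i) * t ^ i) = of_int (coeff p d) * t ^ d + (\<Sum>i<d. of_int (coeff p i) * t ^ i)"
    by (simp flip: lessThan_Suc_atMost)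
  then have "\<bar>of_int (coeff p d) * t ^ d\<bar> = \<bar>\<Sum>i<d. of_int (coeff p i) * t ^ i\<bar>"
    using root unfolding e by simp
  also have "\<dots> \<le> (\<Sum>i<d. \<bar>of_int (coeff p i) * t ^ i\<bar>)" by (rule sum_abs)
  also have "\<dots> \<le> (\<Sum>i<d. \<bar>real_of_int (coeff p i)\<bar> * \<bar>t\<bar> ^ (d - 1))"
    by (rule sum_mono) (use t in \<open>auto simp: abs_mult power_abs intro!: mult_left_mono power_increasing\<close>)
  also have "\<dots> \<le> int_poly_l1 p * \<bar>t\<bar> ^ (d - 1)"
    unfolding l1 sum_distrib_right by (rule sum_mono2) auto
  also have "\<dots> < \<bar>t\<bar> * \<bar>t\<bar> ^ (d - 1)"
    using gt t by (intro mult_strict_right_mono) auto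
  also have "\<dots> = \<bar>t\<bar> ^ d" using d0 by (simp flip: power_Suc)
  also have "\<dots> \<le> \<bar>of_int (coeff p d) * t ^ d\<bar>"
    using mult_right_mono[OF lead, of "\<bar>t\<bar> ^ d"] by (simp add: abs_mult power_abs)
  finally show False by simp
qed

text \<open>Lower powers of \<delta> vanish against \<open>\<delta> ^ K\<close>, so only the
  coefficient at \<open>K\<close> survives.\<close>

lemma ev_div_power_tendsto:
  assumes "degree p \<le> K" and \<delta>: "filterlim \<delta> at_top F"
  shows "((\<lambda>k. ev (\<delta> k) p / \<delta> k ^ K) \<longlongrightarrow> of_int (coeff p K)) F"
proof -
  have e: "ev x p = (\<Sum>i\<le>K. of_int (coeff p i) * x ^ i)" for x
    unfolding ev_def using assms(1) by (subst poly_eq_sum_le[of _ K]) auto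
  have "((\<lambda>k. \<Sum>i\<le>K. of_int (coeff p i) * (\<delta> k ^ i / \<delta> k ^ K)) \<longlongrightarrow>
      (\<Sum>i\<le>K. of_int (coeff p i) * (if i = K then 1 else 0))) F"
  proof (intro tendsto_intros)
    fix i assume i: "i \<in> {..K}"
    have pos: "\<forall>\<^sub>F k in F. 0 < \<delta> k" using \<delta> by (simp add: filterlim_at_top_dense)
    show "((\<lambda>k. \<delta> k ^ i / \<delta> k ^ K) \<longlongrightarrow> (if i = K then 1 else 0)) F"
    proof (cases "i = K")
      case True
      then show ?thesis
        using pos by (auto intro!: tendsto_eventually elim: eventually_mono)
    next
      case False
      then have "((\<lambda>k. inverse (\<delta> k) ^ (K - i)) \<longlongrightarrow> 0 ^ (K - i)) F"
        by (intro tendsto_power tendsto_inverse_0_at_top \<delta>)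
      moreover have "\<forall>\<^sub>F k in F. inverse (\<delta> k) ^ (K - i) = \<delta> k ^ i / \<delta> k ^ K"
        using pos
      proof eventually_elim
        case (elim k)
        have "\<delta> k ^ K = \<delta> k ^ i * \<delta> k ^ (K - i)"
          using i by (simp flip: power_add)
        then show ?case using elim by (simp add: field_simps)
      qed
      ultimately show ?thesis using False i
        by (simp add: power_0_left tendsto_cong)
    qed
  qed
  moreover have "(\<Sum>i\<le>K. of_int (coeff p i) * (if i = K then 1 else 0)) = (of_int (coeff p K) :: real)"
    by (simp add: if_distrib[of "(*) _"] cong: if_cong)
  ultimately show ?thesis
    by (simp add: e sum_divide_distrib)
qed

text \<open>Let \<open>K\<close> be the largest degree in \<delta> among the coefficients of
  \<open>P\<close>. Dividing the root equation by \<open>\<delta> ^ K\<close> and passing to the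
  limit shows that \<open>t0\<close> is a root of \<open>p\<close>, the integer polynomial formed by
  the coefficients of \<open>\<delta> ^ K\<close>. Its coefficient sum is at most that of
  \<open>P\<close>.\<close>

lemma limit_root_bound:
  fixes P :: "int poly poly"
  assumes "P \<noteq> 0"
    and \<delta>: "filterlim \<delta> at_top sequentially"
    and t: "t \<longlonglongrightarrow> t0"
    and root: "\<And>k. poly (map_poly (ev (\<delta> k)) P) (t k) = 0"
  shows "\<bar>t0\<bar> \<le> poly_l1 int_poly_l1 P"
proof -
  define d where "d = degree P"
  define K where "K = (MAX i\<in>{..d}. degree (coeff P i))"
  define p where "p = map_poly (\<lambda>q. coeff q K) P"
  have cp: "coeff p i = coeff (coeff P i) K" for i
    unfolding p_def by (simp add: coeff_map_poly)
  have K: "degree (coeff P i) \<le> K" if "i \<le> d" for i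
    unfolding K_def using that by (intro Max_ge) auto
  have "p \<noteq> 0"
  \<comment> \<open>A zero coefficient also has degree 0, so for \<open>K = 0\<close> the maximum
    may be attained at a vanishing coefficient; the leading coefficient of \<open>P\<close> is used
    instead.\<close>
  proof (cases "K = 0")
    case True
    then have "degree (coeff P d) = 0" using K[of d] by simp
    then have "coeff (coeff P d) 0 \<noteq> 0"
      using assms(1) unfolding d_def by (metis leading_coeff_0_iff)
    then show ?thesis using cp[of d] True by auto
  next
    case False
    have "K \<in> (\<lambda>i. degree (coeff P i)) ` {..d}"
      unfolding K_def by (intro Max_in) auto
    then obtain i where "degree (coeff P i) = K" by auto
    then have "coeff p i \<noteq> 0" using False cp by (metis degree_0 leading_coeff_0_iff)
    then show ?thesis by auto
  qed
  have dp: "degree p \<le> d" unfolding p_def d_def by (rule degree_map_poly_le)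
  have e: "poly (map_poly (ev x) P) y = (\<Sum>i\<le>d. ev x (coeff P i) * y ^ i)" for x y
    unfolding d_def by (subst poly_eq_sum_le[OF degree_map_poly_le]) (simp add: coeff_map_poly)
  have "(\<lambda>k. \<Sum>i\<le>d. ev (\<delta> k) (coeff P i) / \<delta> k ^ K * t k ^ i) \<longlonglongrightarrow>
      (\<Sum>i\<le>d. of_int (coeff (coeff P i) K) * t0 ^ i)"
    by (intro tendsto_intros ev_div_power_tendsto \<delta> t K) auto
  moreover have "(\<Sum>i\<le>d. ev (\<delta> k) (coeff P i) / \<delta> k ^ K * t k ^ i) = 0" for k
  proof -
    have "(\<Sum>i\<le>d. ev (\<delta> k) (coeff P i) / \<delta> k ^ K * t k ^ i) = poly (map_poly (ev (\<delta> k)) P) (t k) / \<delta> k ^ K"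
      unfolding e sum_divide_distrib by (intro sum.cong) auto
    then show ?thesis using root by simp
  qed
  ultimately have "(\<Sum>i\<le>d. of_int (coeff (coeff P i) K) * t0 ^ i) = (0::real)"
    by (simp add: LIMSEQ_const_iff)
  moreover have "ev t0 p = (\<Sum>i\<le>d. of_int (coeff (coeff P i) K) * t0 ^ i)"
    unfolding ev_def using dp by (subst poly_eq_sum_le[of _ d]) (auto simp: cp)
  ultimately have "\<bar>t0\<bar> \<le> int_poly_l1 p"
    using \<open>p \<noteq> 0\<close> by (intro abs_root_le) auto
  also have "\<dots> = (\<Sum>i\<le>degree p. \<bar>real_of_int (coeff (coeff P i) K)\<bar>)"
    by (simp add: poly_l1_eq_sum cp)
  also have "\<dots> \<le> (\<Sum>i\<le>d. \<bar>real_of_int (coeff (coeff P i) K)\<bar>)"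
    using dp by (intro sum_mono2) auto
  also have "\<dots> \<le> (\<Sum>i\<le>d. int_poly_l1 (coeff P i))"
  proof (rule sum_mono)
    fix i
    show "\<bar>real_of_int (coeff (coeff P i) K)\<bar> \<le> int_poly_l1 (coeff P i)"
      by (cases "K \<le> degree (coeff P i)")
        (auto simp: poly_l1_eq_sum coeff_eq_0 intro!: sum_nonneg member_le_sum[where f = "\<lambda>j. \<bar>real_of_int (coeff (coeff P i) j)\<bar>"])
  qed
  also have "\<dots> = poly_l1 int_poly_l1 P"
    unfolding d_def by (simp add: poly_l1_eq_sum)
  finally show ?thesis .
qed

section \<open>Reduction of monomials and elimination\<close>

definition monomial :: "nat \<Rightarrow> (nat \<Rightarrow> nat) \<Rightarrow> (nat \<Rightarrow> real) \<Rightarrow> real" where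
  "monomial N \<alpha> y = (\<Prod>i<N. y i ^ \<alpha> i)"

lemma monomial_mult: "monomial N \<alpha> y * monomial N \<beta> y = monomial N (\<lambda>i. \<alpha> i + \<beta> i) y"
  by (simp add: monomial_def power_add prod.distrib)

lemma monomial_remove:
  "j < N \<Longrightarrow> monomial N \<alpha> y = y j ^ \<alpha> j * (\<Prod>i\<in>{..<N} - {j}. y i ^ \<alpha> i)"
  unfolding monomial_def by (subst prod.remove[of _ j]) auto

lemma monomial_upd:
  "j < N \<Longrightarrow> monomial N (\<alpha>(j := k)) y = y j ^ k * (\<Prod>i\<in>{..<N} - {j}. y i ^ \<alpha> i)"
  by (subst monomial_remove[of j]) (auto intro!: arg_cong2[where f = "(*)"] prod.cong)

text \<open>The additive form avoids truncated subtraction.\<close>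

lemma degree_upd:
  fixes \<alpha> :: "nat \<Rightarrow> nat"
  shows "j < N \<Longrightarrow> (\<Sum>i<N. (\<alpha>(j := k)) i) + \<alpha> j = (\<Sum>i<N. \<alpha> i) + k"
  by (simp add: sum.remove[of "{..<N}" j])

text \<open>Functions given by integer polynomials in the variables \<open>y 0, \<dots>, y (N - 1)\<close> of degree at most
  \<open>d\<close> whose coefficients have absolute values summing up to at most \<open>L\<close>.\<close>

inductive mpoly :: "nat \<Rightarrow> nat \<Rightarrow> real \<Rightarrow> ((nat \<Rightarrow> real) \<Rightarrow> real) \<Rightarrow> bool" for N d where
  zero: "0 \<le> L \<Longrightarrow> mpoly N d L (\<lambda>_. 0)"
| step: "mpoly N d L f \<Longrightarrow> (\<Sum>i<N. \<alpha> i) \<le> d \<Longrightarrow>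
    mpoly N d (\<bar>of_int c\<bar> + L) (\<lambda>y. of_int c * monomial N \<alpha> y + f y)"

lemma mpoly_nonneg: "mpoly N d L f \<Longrightarrow> 0 \<le> L"
  by (induction rule: mpoly.induct) auto

lemma mpoly_weaken:
  assumes "mpoly N d L f" "d \<le> d'" "L \<le> L'"
  shows "mpoly N d' L' f"
  using assms
proof (induction arbitrary: L' rule: mpoly.induct)
  case (zero L)
  then show ?case by (auto intro: mpoly.zero)
next
  case (step L f \<alpha> c)
  have "mpoly N d' (L' - \<bar>of_int c\<bar>) f" using step by (auto intro!: step.IH)
  from mpoly.step[OF this, of \<alpha> c] show ?case using step by simp
qed

lemma mpoly_monomial:
  assumes "(\<Sum>i<N. \<alpha> i) \<le> d"
  shows "mpoly N d \<bar>of_int c\<bar> (\<lambda>y. of_int c * monomial N \<alpha> y)"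
  using mpoly.step[OF mpoly.zero assms, of 0 c] by simp

lemma mpoly_const: "mpoly N d \<bar>of_int c\<bar> (\<lambda>_. of_int c)"
  using mpoly_monomial[of "\<lambda>_. 0" N d c] by (simp add: monomial_def)

lemma mpoly_power_var: "i < N \<Longrightarrow> mpoly N k 1 (\<lambda>y. y i ^ k)"
  using mpoly_monomial[of "(\<lambda>_. 0)(i := k)" N k 1] degree_upd[of i N "\<lambda>_. 0" k]
  by (simp add: monomial_upd)

lemma mpoly_add:
  assumes "mpoly N d L f" "mpoly N d L' g"
  shows "mpoly N d (L + L') (\<lambda>y. f y + g y)"
  using assms(1)
proof (induction rule: mpoly.induct)
  case (zero L)
  then show ?case using assms(2) by (auto intro: mpoly_weaken)
next
  case (step L f \<alpha> c)
  then show ?case using mpoly.step[OF step.IH, of \<alpha> c] by (simp add: add.assoc)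
qed

lemma mpoly_monomial_mult:
  assumes "mpoly N d L f" "(\<Sum>i<N. \<beta> i) \<le> e"
  shows "mpoly N (d + e) (\<bar>of_int b\<bar> * L) (\<lambda>y. of_int b * monomial N \<beta> y * f y)"
  using assms(1)
proof (induction rule: mpoly.induct)
  case (zero L)
  then show ?case by (auto intro: mpoly.zero)
next
  case (step L f \<alpha> c)
  have "mpoly N (d + e) (\<bar>of_int (b * c)\<bar> + \<bar>of_int b\<bar> * L)
    (\<lambda>y. of_int (b * c) * monomial N (\<lambda>i. \<beta> i + \<alpha> i) y + of_int b * monomial N \<beta> y * f y)"
    by (rule mpoly.step[OF step.IH]) (use step assms in \<open>simp add: sum.distrib\<close>)
  then show ?case
    by (simp add: monomial_mult[symmetric] abs_mult algebra_simps)
qed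

lemma mpoly_mult:
  assumes "mpoly N d L f" "mpoly N e L' g"
  shows "mpoly N (d + e) (L * L') (\<lambda>y. f y * g y)"
  using assms(1)
proof (induction rule: mpoly.induct)
  case (zero L)
  then show ?case using mpoly_nonneg[OF assms(2)] by (auto intro: mpoly.zero)
next
  case (step L f \<alpha> c)
  have "mpoly N (d + e) (\<bar>of_int c\<bar> * L' + L * L') (\<lambda>y. of_int c * monomial N \<alpha> y * g y + f y * g y)"
    by (rule mpoly_add[OF _ step.IH], subst add.commute)
      (rule mpoly_monomial_mult[OF assms(2) step.hyps(2)])
  then show ?case by (simp add: algebra_simps)
qed

lemma mpoly_cmult:
  assumes "mpoly N d L f"
  shows "mpoly N d (\<bar>of_int c\<bar> * L) (\<lambda>y. of_int c * f y)"
  using mpoly_mult[OF mpoly_const[of N 0 c] assms] by simp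

lemma mpoly_diff:
  assumes "mpoly N d L f" "mpoly N d L' g"
  shows "mpoly N d (L + L') (\<lambda>y. f y - g y)"
  using mpoly_add[OF assms(1) mpoly_cmult[OF assms(2), of "-1"]] by simp

lemma mpoly_sum:
  fixes L :: real
  assumes "finite I" "\<And>i. i \<in> I \<Longrightarrow> mpoly N d L (f i)"
  shows "mpoly N d (card I * L) (\<lambda>y. \<Sum>i\<in>I. f i y)"
  using assms
proof (induction I rule: finite_induct)
  case (insert x F)
  then show ?case
    using mpoly_add[of N d L "f x" "card F * L" "\<lambda>y. \<Sum>i\<in>F. f i y"] by (simp add: algebra_simps)
qed (simp add: mpoly.zero)

text \<open>Differentiation brings down an exponent, which is at most \<open>d\<close>. The degree
  bound stays \<open>d\<close>, which is enough because later it only has to be below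
  \<open>E\<close>.\<close>

lemma mpoly_partial_derivative:
  assumes "mpoly N d L f" "j < N"
  shows "\<exists>g. mpoly N d (d * L) g \<and>
    (\<forall>y. ((\<lambda>t. f (y(j := t))) has_real_derivative g y) (at (y j)))"
  using assms(1)
proof (induction rule: mpoly.induct)
  case (zero L)
  then show ?case by (intro exI[of _ "\<lambda>_. 0"]) (auto intro: mpoly.zero)
next
  case (step L f \<alpha> c)
  then obtain g where g: "mpoly N d (d * L) g"
    "\<And>y. ((\<lambda>t. f (y(j := t))) has_real_derivative g y) (at (y j))" by blast
  \<comment> \<open>For \<open>\<alpha> j = 0\<close> the truncated exponent is harmless, since the
    coefficient vanishes.\<close>
  define h where "h = (\<lambda>y. of_int (c * int (\<alpha> j)) * monomial N (\<alpha>(j := \<alpha> j - 1)) y)"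
  have aj: "\<alpha> j \<le> d" using step.hyps(2) member_le_sum[of j "{..<N}" \<alpha>] assms(2) by simp
  have "mpoly N d \<bar>of_int (c * int (\<alpha> j))\<bar> h"
    unfolding h_def
    by (rule mpoly_monomial) (use degree_upd[OF assms(2), of \<alpha> "\<alpha> j - 1"] step.hyps(2) in linarith)
  moreover have "\<bar>of_int (c * int (\<alpha> j))\<bar> \<le> d * \<bar>real_of_int c\<bar>"
    using aj mult_right_mono[of "real (\<alpha> j)" d "\<bar>real_of_int c\<bar>"] by (simp add: abs_mult algebra_simps)
  ultimately have h: "mpoly N d (d * \<bar>real_of_int c\<bar>) h"
    by (rule mpoly_weaken[OF _ order_refl])
  have "((\<lambda>t. of_int c * monomial N \<alpha> (y(j := t))) has_real_derivative h y) (at (y j))" for y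
  proof -
    let ?Q = "\<Prod>i\<in>{..<N} - {j}. y i ^ \<alpha> i"
    have "monomial N \<alpha> (y(j := t)) = t ^ \<alpha> j * ?Q" for t
      by (subst monomial_remove[OF assms(2)]) (auto intro!: arg_cong2[where f = "(*)"] prod.cong)
    moreover have "h y = of_int c * (of_nat (\<alpha> j) * y j ^ (\<alpha> j - 1) * ?Q)"
      unfolding h_def by (simp add: monomial_upd[OF assms(2)])
    ultimately show ?thesis
      by (auto intro!: derivative_eq_intros)
  qed
  with g(2) have "((\<lambda>t. of_int c * monomial N \<alpha> (y(j := t)) + f (y(j := t)))
      has_real_derivative h y + g y) (at (y j))" for y
    by (intro DERIV_add)
  moreover have "mpoly N d (d * (\<bar>of_int c\<bar> + L)) (\<lambda>y. h y + g y)"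
    using mpoly_add[OF h g(1)] by (simp add: algebra_simps)
  ultimately show ?case by blast
qed

text \<open>Continuity in the first \<open>N\<close> coordinates, the only ones on which such a
  function depends.\<close>

lemma mpoly_tendsto:
  assumes "mpoly N d L f" "\<And>i. i < N \<Longrightarrow> ((\<lambda>k. y k i) \<longlongrightarrow> y0 i) F"
  shows "((\<lambda>k. f (y k)) \<longlongrightarrow> f y0) F"
  using assms(1)
proof (induction rule: mpoly.induct)
  case (step L f \<alpha> c)
  then show ?case unfolding monomial_def by (auto intro!: tendsto_intros assms(2))
qed simp

section \<open>Rewriting modulo the critical point equations, and elimination\<close>

abbreviation box :: "nat \<Rightarrow> nat \<Rightarrow> (nat \<Rightarrow> nat) set" where
  "box N E \<equiv> {..<N} \<rightarrow>\<^sub>E {..<E}"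

lemma finite_box: "finite (box N E)"
  by (simp add: finite_PiE)

lemma card_box: "card (box N E) = E ^ N"
  by (simp add: card_PiE)

text \<open>If some exponent is at least \<open>E\<close>, a factor \<open>y j ^ E\<close> is
  replaced by \<open>\<delta> * R j y\<close>. Since \<open>d < E\<close>, this lowers the total
  degree, while coefficient sums grow by a factor of at most \<open>A\<close>; hence the power of
  \<open>A\<close>. The coefficients are chosen before \<delta> and \<open>y\<close>, so they are
  genuine polynomials in \<delta>.\<close>

lemma reduce_monomial_to_box:
  fixes A :: real
  assumes R: "\<And>j. j < N \<Longrightarrow> mpoly N d A (R j)" and "d < E" and A: "1 \<le> A"
  shows "\<exists>c. (\<Sum>\<beta>\<in>box N E. int_poly_l1 (c \<beta>)) \<le> A ^ (\<Sum>i<N. \<alpha> i) \<and>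
    (\<forall>\<delta> y. (\<forall>i<N. y i ^ E = \<delta> * R i y) \<longrightarrow>
      monomial N \<alpha> y = (\<Sum>\<beta>\<in>box N E. ev \<delta> (c \<beta>) * monomial N \<beta> y))"
proof (induction "\<Sum>i<N. \<alpha> i" arbitrary: \<alpha> rule: less_induct)
  case less
  show ?case
  proof (cases "\<forall>i<N. \<alpha> i < E")
    case True
    define \<beta>0 where "\<beta>0 = restrict \<alpha> {..<N}"
    have b: "\<beta>0 \<in> box N E" unfolding \<beta>0_def using True by auto
    have m: "monomial N \<alpha> y = monomial N \<beta>0 y" for y
      unfolding monomial_def \<beta>0_def by (rule prod.cong) auto
    have "(\<Sum>\<beta>\<in>box N E. int_poly_l1 (if \<beta> = \<beta>0 then 1 else 0)) =
        (\<Sum>\<beta>\<in>box N E. if \<beta> = \<beta>0 then 1 else 0)"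
      by (rule sum.cong) (simp_all add: one_pCons)
    also have "\<dots> = 1" using b by (simp add: finite_box)
    finally have "(\<Sum>\<beta>\<in>box N E. int_poly_l1 (if \<beta> = \<beta>0 then 1 else 0)) = 1" .
    moreover have "monomial N \<alpha> y = (\<Sum>\<beta>\<in>box N E. ev \<delta> (if \<beta> = \<beta>0 then 1 else 0) * monomial N \<beta> y)"
      for \<delta> y
      using b m by (simp add: if_distrib[of "ev _"] if_distrib[of "\<lambda>x. x * _"] finite_box cong: if_cong)
    ultimately show ?thesis using one_le_power[OF A]
      by (intro exI[of _ "\<lambda>\<beta>. if \<beta> = \<beta>0 then 1 else 0"]) simp
  next
    case False
    then obtain j where j: "j < N" "E \<le> \<alpha> j" by (auto simp: not_less)
    define \<alpha>' where "\<alpha>' = \<alpha>(j := \<alpha> j - E)"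
    have dg: "(\<Sum>i<N. \<alpha>' i) + E = (\<Sum>i<N. \<alpha> i)"
      using degree_upd[OF j(1), of \<alpha> "\<alpha> j - E"] j(2) unfolding \<alpha>'_def by linarith
    have pow: "monomial N \<alpha> y = y j ^ E * monomial N \<alpha>' y" for y
    proof -
      have "y j ^ \<alpha> j = y j ^ E * y j ^ (\<alpha> j - E)" using j(2) by (simp flip: power_add)
      then show ?thesis unfolding \<alpha>'_def using j(1) by (simp add: monomial_upd monomial_remove)
    qed
    let ?B = "A ^ ((\<Sum>i<N. \<alpha> i) - 1)"
    \<comment> \<open>Induction along the construction of \<open>R j\<close>, stated for a general
      \<open>f\<close>: each term times \<open>monomial N \<alpha>'\<close> has smaller degree than
      \<open>\<alpha>\<close>, so the outer induction hypothesis bounds its expansion by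
      \<open>?B\<close>.\<close>
    have "\<exists>c. (\<Sum>\<beta>\<in>box N E. int_poly_l1 (c \<beta>)) \<le> L * ?B \<and>
      (\<forall>\<delta> y. (\<forall>i<N. y i ^ E = \<delta> * R i y) \<longrightarrow>
        monomial N \<alpha>' y * f y = (\<Sum>\<beta>\<in>box N E. ev \<delta> (c \<beta>) * monomial N \<beta> y))"
      if "mpoly N d L f" for L f
      using that
    proof (induction rule: mpoly.induct)
      case (zero L)
      then show ?case using A by (intro exI[of _ "\<lambda>_. 0"]) simp
    next
      case (step L f \<gamma> b)
      from step.IH obtain c1 where
        c1: "(\<Sum>\<beta>\<in>box N E. int_poly_l1 (c1 \<beta>)) \<le> L * ?B"
        "\<And>\<delta> y. \<forall>i<N. y i ^ E = \<delta> * R i y \<Longrightarrow>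
          monomial N \<alpha>' y * f y = (\<Sum>\<beta>\<in>box N E. ev \<delta> (c1 \<beta>) * monomial N \<beta> y)" by blast
      have lt: "(\<Sum>i<N. \<alpha>' i + \<gamma> i) < (\<Sum>i<N. \<alpha> i)"
        using dg \<open>d < E\<close> step.hyps(2) by (simp add: sum.distrib)
      from less[OF this] obtain c2 where
        c2: "(\<Sum>\<beta>\<in>box N E. int_poly_l1 (c2 \<beta>)) \<le> A ^ (\<Sum>i<N. \<alpha>' i + \<gamma> i)"
        "\<And>\<delta> y. \<forall>i<N. y i ^ E = \<delta> * R i y \<Longrightarrow>
          monomial N (\<lambda>i. \<alpha>' i + \<gamma> i) y = (\<Sum>\<beta>\<in>box N E. ev \<delta> (c2 \<beta>) * monomial N \<beta> y)" by blast
      have "A ^ (\<Sum>i<N. \<alpha>' i + \<gamma> i) \<le> ?B"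
        using lt A by (intro power_increasing) auto
      with c2(1) have c2': "(\<Sum>\<beta>\<in>box N E. int_poly_l1 (c2 \<beta>)) \<le> ?B" by linarith
      define c where "c = (\<lambda>\<beta>. [:b:] * c2 \<beta> + c1 \<beta>)"
      have "int_poly_l1 (c \<beta>) \<le> \<bar>of_int b\<bar> * int_poly_l1 (c2 \<beta>) + int_poly_l1 (c1 \<beta>)" for \<beta>
        using int_poly_l1.add[of "[:b:] * c2 \<beta>" "c1 \<beta>"] int_poly_l1.mult[of "[:b:]" "c2 \<beta>"]
        unfolding c_def by simp
      then have "(\<Sum>\<beta>\<in>box N E. int_poly_l1 (c \<beta>)) \<le>
          (\<Sum>\<beta>\<in>box N E. \<bar>of_int b\<bar> * int_poly_l1 (c2 \<beta>) + int_poly_l1 (c1 \<beta>))"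
        by (intro sum_mono)
      also have "\<dots> \<le> \<bar>of_int b\<bar> * ?B + L * ?B"
        unfolding sum.distrib sum_distrib_left[symmetric]
        by (intro add_mono mult_left_mono c1(1) c2') simp
      finally have "(\<Sum>\<beta>\<in>box N E. int_poly_l1 (c \<beta>)) \<le> (\<bar>of_int b\<bar> + L) * ?B"
        by (simp add: algebra_simps)
      moreover have "monomial N \<alpha>' y * (of_int b * monomial N \<gamma> y + f y) =
          (\<Sum>\<beta>\<in>box N E. ev \<delta> (c \<beta>) * monomial N \<beta> y)"
        if "\<forall>i<N. y i ^ E = \<delta> * R i y" for \<delta> y
      proof -
        have "ev \<delta> (c \<beta>) = of_int b * ev \<delta> (c2 \<beta>) + ev \<delta> (c1 \<beta>)" for \<beta>
          unfolding c_def ev.hom_add ev.hom_mult by (simp add: ev_pCons)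
        then have "(\<Sum>\<beta>\<in>box N E. ev \<delta> (c \<beta>) * monomial N \<beta> y) =
            of_int b * monomial N (\<lambda>i. \<alpha>' i + \<gamma> i) y + monomial N \<alpha>' y * f y"
          unfolding c1(2)[OF that] c2(2)[OF that]
          by (simp add: algebra_simps sum.distrib sum_distrib_left)
        then show ?thesis by (simp add: algebra_simps flip: monomial_mult)
      qed
      ultimately show ?case by blast
    qed
    from this[OF R[OF j(1)]] obtain c where
      c: "(\<Sum>\<beta>\<in>box N E. int_poly_l1 (c \<beta>)) \<le> A * ?B"
      "\<And>\<delta> y. \<forall>i<N. y i ^ E = \<delta> * R i y \<Longrightarrow>
        monomial N \<alpha>' y * R j y = (\<Sum>\<beta>\<in>box N E. ev \<delta> (c \<beta>) * monomial N \<beta> y)" by blast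
    \<comment> \<open>Positivity makes the subtraction in the exponent of \<open>?B\<close>
      genuine.\<close>
    have "0 < (\<Sum>i<N. \<alpha> i)" using dg \<open>d < E\<close> by linarith
    then have "A * ?B = A ^ (\<Sum>i<N. \<alpha> i)" by (simp flip: power_Suc)
    \<comment> \<open>Multiplication by \<delta> is \<open>pCons 0\<close>, which leaves coefficient
      sums unchanged.\<close>
    then have "(\<Sum>\<beta>\<in>box N E. int_poly_l1 (pCons 0 (c \<beta>))) \<le> A ^ (\<Sum>i<N. \<alpha> i)"
      using c(1) by simp
    moreover have "monomial N \<alpha> y = (\<Sum>\<beta>\<in>box N E. ev \<delta> (pCons 0 (c \<beta>)) * monomial N \<beta> y)"
      if y: "\<forall>i<N. y i ^ E = \<delta> * R i y" for \<delta> y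
    proof -
      have "(\<Sum>\<beta>\<in>box N E. ev \<delta> (pCons 0 (c \<beta>)) * monomial N \<beta> y) = \<delta> * (monomial N \<alpha>' y * R j y)"
        unfolding c(2)[OF y] by (simp add: ev_pCons sum_distrib_left mult.assoc)
      also have "\<dots> = y j ^ E * monomial N \<alpha>' y" using y j(1) by simp
      finally show ?thesis by (simp add: pow)
    qed
    ultimately show ?thesis by (intro exI[of _ "\<lambda>\<beta>. pCons 0 (c \<beta>)"]) blast
  qed
qed

text \<open>Expressing \<open>y j\<close> times each box monomial in box monomials gives a matrix
  \<open>M\<close> of size \<open>E ^ N\<close> over the polynomials in \<delta>. At every solution
  the vector of box monomials is an eigenvector with eigenvalue \<open>y j\<close>, so
  \<open>P\<close> can be the characteristic polynomial of \<open>M\<close>. It is monic, hence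
  nonzero.\<close>

lemma elimination:
  fixes A :: real
  assumes R: "\<And>j. j < N \<Longrightarrow> mpoly N d A (R j)" and "d < E" and A: "1 \<le> A" and j: "j < N"
  shows "\<exists>P :: int poly poly. P \<noteq> 0 \<and>
    poly_l1 int_poly_l1 P \<le> fact (E ^ N) * (1 + A ^ (N * E)) ^ (E ^ N) \<and>
    (\<forall>\<delta> y. (\<forall>i<N. y i ^ E = \<delta> * R i y) \<longrightarrow> poly (map_poly (ev \<delta>) P) (y j) = 0)"
proof -
  define D where "D = E ^ N"
  obtain h where "bij_betw h {0..<card (box N E)} (box N E)"
    using ex_bij_betw_nat_finite[OF finite_box] by blast
  then have h: "bij_betw h {0..<D} (box N E)" unfolding D_def card_box .
  then have hb: "h k \<in> box N E" if "k < D" for k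
    using that bij_betwE[OF h] by auto
  have "\<forall>\<alpha>. \<exists>c. (\<Sum>\<beta>\<in>box N E. int_poly_l1 (c \<beta>)) \<le> A ^ (\<Sum>i<N. \<alpha> i) \<and>
    (\<forall>\<delta> y. (\<forall>i<N. y i ^ E = \<delta> * R i y) \<longrightarrow>
      monomial N \<alpha> y = (\<Sum>\<beta>\<in>box N E. ev \<delta> (c \<beta>) * monomial N \<beta> y))"
    by (intro allI reduce_monomial_to_box[where R = R]) (use R \<open>d < E\<close> A in auto)
  from choice[OF this] obtain c where "\<forall>\<alpha>. (\<Sum>\<beta>\<in>box N E. int_poly_l1 (c \<alpha> \<beta>)) \<le> A ^ (\<Sum>i<N. \<alpha> i) \<and>
    (\<forall>\<delta> y. (\<forall>i<N. y i ^ E = \<delta> * R i y) \<longrightarrow>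
      monomial N \<alpha> y = (\<Sum>\<beta>\<in>box N E. ev \<delta> (c \<alpha> \<beta>) * monomial N \<beta> y))" ..
  then have c_l1: "(\<Sum>\<beta>\<in>box N E. int_poly_l1 (c \<alpha> \<beta>)) \<le> A ^ (\<Sum>i<N. \<alpha> i)"
    and c: "\<forall>i<N. y i ^ E = \<delta> * R i y \<Longrightarrow>
      monomial N \<alpha> y = (\<Sum>\<beta>\<in>box N E. ev \<delta> (c \<alpha> \<beta>) * monomial N \<beta> y)" for \<alpha> \<delta> y
    by simp_all
  \<comment> \<open>The exponents of \<open>y j\<close> times the \<open>k\<close>-th box
    monomial.\<close>
  define s where "s = (\<lambda>k. (h k)(j := Suc (h k j)))"
  define M where "M = mat D D (\<lambda>(k, l). c (s k) (h l))"
  have M: "M \<in> carrier_mat D D" unfolding M_def by simp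
  define P where "P = char_poly M"
  have "P \<noteq> 0" using degree_monic_char_poly[OF M] unfolding P_def by auto
  moreover have "poly_l1 int_poly_l1 P \<le> fact D * (1 + A ^ (N * E)) ^ D"
    unfolding P_def
  proof (rule int_poly_l1.char_poly_l1_le[OF M])
    fix k l assume kl: "k < D" "l < D"
    have "int_poly_l1 (M $$ (k, l)) = int_poly_l1 (c (s k) (h l))" using kl by (simp add: M_def)
    also have "\<dots> \<le> (\<Sum>\<beta>\<in>box N E. int_poly_l1 (c (s k) \<beta>))"
      by (rule member_le_sum) (use hb kl in \<open>auto simp: int_poly_l1.nonneg finite_box\<close>)
    also have "\<dots> \<le> A ^ (\<Sum>i<N. s k i)" by (rule c_l1)
    \<comment> \<open>Box exponents are at most \<open>E - 1\<close> and only the one at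
      \<open>j\<close> is raised, by one.\<close>
    also have "(\<Sum>i<N. s k i) \<le> (\<Sum>i<N. E)"
      using PiE_mem[OF hb[OF kl(1)]] j by (intro sum_mono) (simp add: s_def Suc_le_eq less_imp_le)
    then have "A ^ (\<Sum>i<N. s k i) \<le> A ^ (N * E)"
      using A by (intro power_increasing) auto
    finally show "int_poly_l1 (M $$ (k, l)) \<le> A ^ (N * E)" by simp
  qed
  moreover have "poly (map_poly (ev \<delta>) P) (y j) = 0" if y: "\<forall>i<N. y i ^ E = \<delta> * R i y" for \<delta> y
  proof -
    define M' where "M' = map_mat (ev \<delta>) M"
    define v where "v = vec D (\<lambda>l. monomial N (h l) y)"
    have M': "M' \<in> carrier_mat D D" unfolding M'_def using M by simp
    have "M' *\<^sub>v v = y j \<cdot>\<^sub>v v"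
    proof (rule eq_vecI)
      fix k assume "k < dim_vec (y j \<cdot>\<^sub>v v)"
      then have k: "k < D" unfolding v_def by simp
      have "(M' *\<^sub>v v) $ k = (\<Sum>l = 0..<D. ev \<delta> (c (s k) (h l)) * monomial N (h l) y)"
        using k by (simp add: M'_def M_def v_def scalar_prod_def)
      also have "\<dots> = (\<Sum>\<beta>\<in>box N E. ev \<delta> (c (s k) \<beta>) * monomial N \<beta> y)"
        using sum.reindex_bij_betw[OF h, of "\<lambda>\<beta>. ev \<delta> (c (s k) \<beta>) * monomial N \<beta> y"] .
      also have "\<dots> = monomial N (s k) y" by (rule c[OF y, symmetric])
      also have "\<dots> = y j * monomial N (h k) y"
        unfolding s_def monomial_upd[OF j] monomial_remove[OF j, of "h k"] by simp
      finally show "(M' *\<^sub>v v) $ k = (y j \<cdot>\<^sub>v v) $ k" using k by (simp add: v_def)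
    qed (simp add: v_def M'_def M_def)
    \<comment> \<open>The box contains the constant monomial, whose value is 1.\<close>
    moreover have "v \<noteq> 0\<^sub>v D"
    proof
      assume v0: "v = 0\<^sub>v D"
      have "restrict (\<lambda>_. 0) {..<N} \<in> box N E" using \<open>d < E\<close> by auto
      then have "restrict (\<lambda>_. 0) {..<N} \<in> h ` {0..<D}"
        unfolding bij_betw_imp_surj_on[OF h] .
      then obtain l where l: "l < D" "h l = restrict (\<lambda>_. 0) {..<N}"
        by (elim imageE) simp
      then have "v $ l = 1" unfolding v_def by (simp add: monomial_def)
      then show False using v0 l(1) by simp
    qed
    ultimately have "eigenvalue M' (y j)"
      unfolding eigenvalue_def eigenvector_def using M' by (intro exI[of _ v]) (simp add: v_def)
    then have "poly (char_poly M') (y j) = 0"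
      using eigenvalue_root_char_poly[OF M'] by simp
    then show ?thesis unfolding P_def M'_def ev.char_poly_hom[OF M] .
  qed
  ultimately show ?thesis unfolding D_def by blast
qed

section \<open>A bounded zero of a nonnegative polynomial\<close>

text \<open>Bolzano-Weierstrass, one coordinate at a time: a monotone subsequence of a bounded real
  sequence converges, and the limits found earlier persist.\<close>

lemma bounded_coordinates_convergent_subseq:
  fixes y :: "nat \<Rightarrow> nat \<Rightarrow> real"
  assumes "\<And>k i. i < N \<Longrightarrow> \<bar>y k i\<bar> \<le> C"
  shows "\<exists>r y0. strict_mono (r :: nat \<Rightarrow> nat) \<and> (\<forall>i<N. (\<lambda>k. y (r k) i) \<longlonglongrightarrow> y0 i)"
  using assms
proof (induction N)
  case 0
  then show ?case by (intro exI[of _ id]) (auto simp: strict_mono_def)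
next
  case (Suc N)
  then obtain r y0 where r: "strict_mono r" "\<And>i. i < N \<Longrightarrow> (\<lambda>k. y (r k) i) \<longlonglongrightarrow> y0 i"
    by (metis less_Suc_eq)
  obtain s where s: "strict_mono s" "monoseq (\<lambda>k. y (r (s k)) N)"
    using seq_monosub[of "\<lambda>k. y (r k) N"] by blast
  have "Bseq (\<lambda>k. y (r (s k)) N)"
    by (rule BseqI'[of _ C]) (use Suc.prems in simp)
  then obtain l where l: "(\<lambda>k. y (r (s k)) N) \<longlonglongrightarrow> l"
    using Bseq_monoseq_convergent s(2) unfolding convergent_def by blast
  have "(\<lambda>k. y (r (s k)) i) \<longlonglongrightarrow> (y0(N := l)) i" if "i < Suc N" for i
  proof (cases "i = N")
    case False
    then show ?thesis
      using LIMSEQ_subseq_LIMSEQ[OF r(2)[of i] s(1)] that by (simp add: o_def)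
  qed (simp add: l)
  then show ?case
    using strict_mono_o[OF r(1) s(1)]
    by (intro exI[of _ "\<lambda>k. r (s k)"] exI[of _ "y0(N := l)"]) (simp add: o_def)
qed

text \<open>A crude estimate that avoids taking roots.\<close>

lemma abs_le_of_power_le:
  fixes t :: real
  assumes "\<bar>t\<bar> ^ q \<le> a" "0 < q"
  shows "\<bar>t\<bar> \<le> 1 + a"
proof (cases "1 \<le> \<bar>t\<bar>")
  case True
  then show ?thesis using self_le_power[OF True assms(2)] assms(1) by simp
next
  case False
  have "0 \<le> a" using order_trans[OF zero_le_power assms(1)] by simp
  with False show ?thesis by simp
qed

text \<open>The even powers make the function coercive: a minimising sequence is bounded in its
  first \<open>N\<close> coordinates, and a subsequential limit attains the infimum.\<close>

lemma regularized_minimum: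
  fixes c :: real
  assumes Q: "mpoly N d L Q" and Q0: "\<And>y. 0 \<le> Q y" and c: "0 < c" and q: "even q" "0 < q"
  shows "\<exists>y. \<forall>z. Q y + c * (\<Sum>i<N. y i ^ q) \<le> Q z + c * (\<Sum>i<N. z i ^ q)"
proof -
  define f where "f = (\<lambda>y. Q y + c * (\<Sum>i<N. y i ^ q))"
  have pw: "0 \<le> x ^ q" for x :: real using q(1) by (simp add: zero_le_even_power)
  have f0: "0 \<le> f y" for y
    unfolding f_def using c by (intro add_nonneg_nonneg mult_nonneg_nonneg sum_nonneg Q0 pw) auto
  define m where "m = (INF y. f y)"
  have bdd: "bdd_below (range f)" by (rule bdd_belowI[of _ 0]) (auto simp: f0)
  have ml: "m \<le> f y" for y unfolding m_def by (rule cINF_lower[OF bdd]) simp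
  have "\<exists>y. f y < m + inverse (real (Suc k))" for k
    using cINF_less_iff[OF _ bdd, of "m + inverse (real (Suc k))"] unfolding m_def by auto
  then obtain y where y: "\<And>k. f (y k) < m + inverse (real (Suc k))" by metis
  have "\<bar>y k i\<bar> \<le> 1 + (m + 1) / c" if "i < N" for k i
  proof (rule abs_le_of_power_le[OF _ q(2)])
    have "c * y k i ^ q \<le> c * (\<Sum>i<N. y k i ^ q)"
      using c that pw by (intro mult_left_mono member_le_sum) auto
    also have "\<dots> \<le> f (y k)" unfolding f_def using Q0 by simp
    also have "\<dots> \<le> m + inverse (real (Suc k))" using y less_imp_le by blast
    also have "\<dots> \<le> m + 1" by (simp add: inverse_eq_divide)
    finally show "\<bar>y k i\<bar> ^ q \<le> (m + 1) / c"
      using c q(1) by (simp add: power_even_abs field_simps)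
  qed
  then obtain r y0 where r: "strict_mono r" "\<And>i. i < N \<Longrightarrow> (\<lambda>k. y (r k) i) \<longlonglongrightarrow> y0 i"
    using bounded_coordinates_convergent_subseq[of N y "1 + (m + 1) / c"] by blast
  have "(\<lambda>k. f (y (r k))) \<longlonglongrightarrow> f y0"
    unfolding f_def by (intro tendsto_intros mpoly_tendsto[OF Q] r(2)) auto
  moreover have "(\<lambda>k. m + inverse (real (Suc (r k)))) \<longlonglongrightarrow> m"
    using LIMSEQ_subseq_LIMSEQ[OF LIMSEQ_inverse_real_of_nat_add[of m] r(1)] by (simp add: o_def)
  ultimately have "f y0 \<le> m"
    by (rule LIMSEQ_le) (use y less_imp_le in blast)
  then show ?thesis using ml unfolding f_def by (meson order_trans)
qed

text \<open>The given zero \<open>y0\<close> only confines the minimisers, by comparison of values;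
  the final bound comes from \<open>elimination\<close> and does not depend on \<open>y0\<close>.
  Oddness of \<open>E\<close> makes the regulariser, of exponent \<open>E + 1\<close>, nonnegative,
  and \<open>d < E\<close> lets the reduction terminate.\<close>

theorem bounded_real_zero:
  assumes Q: "mpoly N d L Q" and Q0: "\<And>y. 0 \<le> Q y" and zero: "Q y0 = 0"
    and "d < E" "odd E" and A: "1 \<le> d * L"
  shows "\<exists>y. Q y = 0 \<and> (\<forall>j<N. \<bar>y j\<bar> \<le> fact (E ^ N) * (1 + (d * L) ^ (N * E)) ^ (E ^ N))"
proof -
  define S where "S = (\<Sum>i<N. y0 i ^ Suc E)"
  define \<delta> where "\<delta> = (\<lambda>k. real (Suc k))"
  \<comment> \<open>Chosen so that the derivative of \<open>c k * t ^ Suc E\<close> is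
    \<open>t ^ E / \<delta> k\<close>.\<close>
  define c where "c = (\<lambda>k. 1 / (real (Suc E) * \<delta> k))"
  have \<delta>: "0 < \<delta> k" for k unfolding \<delta>_def by simp
  have c: "0 < c k" for k unfolding c_def using \<delta> by simp
  have pw: "0 \<le> x ^ Suc E" for x :: real
    using \<open>odd E\<close> by (intro zero_le_even_power) simp
  have "\<forall>k. \<exists>y. \<forall>z. Q y + c k * (\<Sum>i<N. y i ^ Suc E) \<le> Q z + c k * (\<Sum>i<N. z i ^ Suc E)"
    using regularized_minimum[OF Q Q0 c, of "Suc E"] \<open>odd E\<close> by simp
  then obtain y where y: "\<And>k z. Q (y k) + c k * (\<Sum>i<N. y k i ^ Suc E)
      \<le> Q z + c k * (\<Sum>i<N. z i ^ Suc E)" by metis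
  have "\<forall>j. \<exists>g. j < N \<longrightarrow> mpoly N d (d * L) g \<and>
    (\<forall>y. ((\<lambda>t. Q (y(j := t))) has_real_derivative g y) (at (y j)))"
    using mpoly_partial_derivative[OF Q] by blast
  then obtain g where g: "\<And>j. j < N \<Longrightarrow> mpoly N d (d * L) (g j)"
    "\<And>j y. j < N \<Longrightarrow> ((\<lambda>t. Q (y(j := t))) has_real_derivative g j y) (at (y j))" by metis
  define R where "R = (\<lambda>j y. - g j y)"
  have R: "mpoly N d (d * L) (R j)" if "j < N" for j
    using mpoly_cmult[OF g(1)[OF that], of "-1"] unfolding R_def by simp
  have crit: "y k j ^ E = \<delta> k * R j (y k)" if j: "j < N" for k j
  proof -
    define s where "s = (\<Sum>i\<in>{..<N} - {j}. y k i ^ Suc E)"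
    \<comment> \<open>The regularised function on the \<open>j\<close>-th coordinate line through
      \<open>y k\<close>. It is minimal at \<open>y k j\<close>, so its derivative vanishes
      there.\<close>
    define \<phi> where "\<phi> = (\<lambda>t. Q ((y k)(j := t)) + c k * (t ^ Suc E + s))"
    have sum: "(\<Sum>i<N. ((y k)(j := t)) i ^ Suc E) = t ^ Suc E + s" for t
      unfolding s_def using j by (subst sum.remove[of _ j]) (auto intro!: sum.cong)
    have le: "\<phi> (y k j) \<le> \<phi> t" for t
      using y[of k "(y k)(j := t)"] sum[of t] sum[of "y k j"] unfolding \<phi>_def by simp
    have "(\<phi> has_real_derivative g j (y k) + c k * (real (Suc E) * y k j ^ E)) (at (y k j))"
      unfolding \<phi>_def by (rule derivative_eq_intros g(2)[OF j] refl | simp)+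
    then have "g j (y k) + c k * (real (Suc E) * y k j ^ E) = 0"
      by (rule DERIV_local_min[of _ _ _ 1]) (auto simp: le)
    then show ?thesis using \<delta>[of k] unfolding c_def R_def by (simp add: field_simps del: of_nat_Suc)
  qed
  have S: "(\<Sum>i<N. y k i ^ Suc E) \<le> S" for k
  proof -
    \<comment> \<open>Comparison of the minimiser with \<open>y0\<close>, where \<open>Q\<close>
      vanishes.\<close>
    have "c k * (\<Sum>i<N. y k i ^ Suc E) \<le> c k * S"
      using y[of k y0] Q0[of "y k"] zero unfolding S_def by linarith
    then show ?thesis using c[of k] by simp
  qed
  have "\<bar>y k i\<bar> \<le> 1 + S" if "i < N" for k i
  proof (rule abs_le_of_power_le[of _ "Suc E"])
    have "y k i ^ Suc E \<le> (\<Sum>i<N. y k i ^ Suc E)"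
      using that pw by (intro member_le_sum[where f = "\<lambda>i. y k i ^ Suc E"]) auto
    then show "\<bar>y k i\<bar> ^ Suc E \<le> S" using S[of k] \<open>odd E\<close> power_even_abs[of "Suc E" "y k i"] by simp
  qed simp
  then obtain r y' where r: "strict_mono r" "\<And>i. i < N \<Longrightarrow> (\<lambda>k. y (r k) i) \<longlonglongrightarrow> y' i"
    using bounded_coordinates_convergent_subseq[of N y "1 + S"] by blast
  have \<delta>_lim: "filterlim (\<lambda>k. \<delta> (r k)) at_top sequentially"
    unfolding \<delta>_def using filterlim_subseq[OF r(1)]
    by (intro filterlim_compose[OF filterlim_real_sequentially] filterlim_compose[OF filterlim_Suc])
  have "(\<lambda>k. Q (y (r k))) \<longlonglongrightarrow> Q y'"
    by (intro mpoly_tendsto[OF Q] r(2))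
  moreover have "(\<lambda>k. S * inverse (\<delta> (r k))) \<longlonglongrightarrow> S * 0"
    by (intro tendsto_intros tendsto_inverse_0_at_top \<delta>_lim)
  moreover have "Q (y k) \<le> S * inverse (\<delta> k)" for k
  proof -
    have "0 \<le> c k * (\<Sum>i<N. y k i ^ Suc E)"
      using c[of k] pw by (intro mult_nonneg_nonneg sum_nonneg) auto
    then have "Q (y k) \<le> c k * S"
      using y[of k y0] zero unfolding S_def by linarith
    also have "\<dots> \<le> inverse (\<delta> k) * S"
    proof (rule mult_right_mono)
      show "0 \<le> S" unfolding S_def by (intro sum_nonneg pw)
      show "c k \<le> inverse (\<delta> k)"
        unfolding c_def inverse_eq_divide
        using \<delta>[of k] mult_right_mono[of 1 "real (Suc E)" "\<delta> k"]
        by (intro divide_left_mono) simp_all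
    qed
    finally show ?thesis by (simp add: mult.commute)
  qed
  ultimately have "Q y' \<le> S * 0"
    by (intro LIMSEQ_le[of "\<lambda>k. Q (y (r k))"]) auto
  then have "Q y' = 0" using Q0[of y'] by simp
  moreover have "\<bar>y' j\<bar> \<le> fact (E ^ N) * (1 + (d * L) ^ (N * E)) ^ (E ^ N)" if j: "j < N" for j
  proof -
    obtain P :: "int poly poly" where P: "P \<noteq> 0"
      "poly_l1 int_poly_l1 P \<le> fact (E ^ N) * (1 + (d * L) ^ (N * E)) ^ (E ^ N)"
      "\<And>\<delta> y. \<forall>i<N. y i ^ E = \<delta> * R i y \<Longrightarrow> poly (map_poly (ev \<delta>) P) (y j) = 0"
      using elimination[where R = R, OF R \<open>d < E\<close> A j] by blast
    have "\<bar>y' j\<bar> \<le> poly_l1 int_poly_l1 P"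
      by (rule limit_root_bound[OF P(1) \<delta>_lim r(2)[OF j]]) (use P(3) crit in blast)
    with P(2) show ?thesis by linarith
  qed
  ultimately show ?thesis by blast
qed

section \<open>Feasible points on faces of the cone\<close>

text \<open>With \<open>w = z + z'\<close>, the vector \<open>x + x'\<close> is \<open>w\<close>
  times the convex combination of \<open>x / z\<close> and \<open>x' / z'\<close> with weights
  \<open>z / w\<close> and \<open>z' / w\<close>; convexity of the even power then applies in each
  coordinate.\<close>

lemma power_cone_add:
  fixes x x' :: "nat \<Rightarrow> real"
  assumes r: "even r" "0 < r" and z: "0 \<le> z" "0 \<le> z'"
    and x: "(\<Sum>i<n. x i ^ r) \<le> z ^ r" and x': "(\<Sum>i<n. x' i ^ r) \<le> z' ^ r"
  shows "(\<Sum>i<n. (x i + x' i) ^ r) \<le> (z + z') ^ r"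
proof -
  have pw: "0 \<le> t ^ r" for t :: real using r(1) by (rule zero_le_even_power)
  have vanish: "u i = 0" if "(\<Sum>i<n. u i ^ r) \<le> 0 ^ r" "i < n" for u :: "nat \<Rightarrow> real" and i
  proof -
    have "(\<Sum>i<n. u i ^ r) = 0"
      using that(1) r(2) pw by (intro order_antisym sum_nonneg) (simp_all add: power_0_left)
    then show ?thesis using that(2) r(2) pw by (simp add: sum_nonneg_eq_0_iff)
  qed
  consider "z = 0" | "z' = 0" | "0 < z" "0 < z'" using z by linarith
  then show ?thesis
  proof cases
    case 1
    then have "(\<Sum>i<n. (x i + x' i) ^ r) = (\<Sum>i<n. x' i ^ r)"
      using vanish[of x] x by (intro sum.cong) auto
    then show ?thesis using 1 x' by simp
  next
    case 2
    then have "(\<Sum>i<n. (x i + x' i) ^ r) = (\<Sum>i<n. x i ^ r)"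
      using vanish[of x'] x' by (intro sum.cong) auto
    then show ?thesis using 2 x by simp
  next
    case 3
    define w where "w = z + z'"
    define s where "s = z' / w"
    have w: "0 < w" using 3 unfolding w_def by simp
    have s: "0 \<le> s" "s \<le> 1" "1 - s = z / w"
      using 3 unfolding s_def w_def by (auto simp: field_simps)
    have "(x i + x' i) ^ r \<le> w ^ r * ((1 - s) * (x i / z) ^ r + s * (x' i / z') ^ r)" for i
    proof -
      have ws: "w * (1 - s) = z" "w * s = z'" using w s(3) by (simp, simp add: s_def)
      have "w * ((1 - s) * (x i / z) + s * (x' i / z')) = w * (1 - s) * (x i / z) + w * s * (x' i / z')"
        by (simp only: distrib_left mult.assoc)
      then have "x i + x' i = w * ((1 - s) * (x i / z) + s * (x' i / z'))"
        unfolding ws using 3 by simp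
      then have "(x i + x' i) ^ r = w ^ r * ((1 - s) * (x i / z) + s * (x' i / z')) ^ r"
        by (simp add: power_mult_distrib)
      also have "\<dots> \<le> w ^ r * ((1 - s) * (x i / z) ^ r + s * (x' i / z') ^ r)"
        using convex_onD[OF convex_power_even[OF r(1)] s(1,2), of "x i / z" "x' i / z'"] w
        by (intro mult_left_mono) auto
      finally show ?thesis .
    qed
    then have "(\<Sum>i<n. (x i + x' i) ^ r) \<le>
        (\<Sum>i<n. w ^ r * ((1 - s) * (x i / z) ^ r + s * (x' i / z') ^ r))"
      by (rule sum_mono)
    also have "\<dots> = w ^ r * ((1 - s) * ((\<Sum>i<n. x i ^ r) / z ^ r) + s * ((\<Sum>i<n. x' i ^ r) / z' ^ r))"
      by (simp add: sum_distrib_left sum.distrib sum_divide_distrib power_divide algebra_simps)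
    also have "\<dots> \<le> w ^ r * ((1 - s) * 1 + s * 1)"
      using 3 x x' s w by (intro mult_left_mono add_mono) (auto simp: divide_le_eq)
    finally show ?thesis unfolding w_def by simp
  qed
qed

text \<open>The cone is closed under nonnegative scaling and addition.\<close>

lemma power_cone_convex:
  fixes x x' :: "nat \<Rightarrow> real"
  assumes r: "even r" "0 < r" and z: "0 \<le> z" "0 \<le> z'" and t: "0 \<le> t" "t \<le> 1"
    and x: "(\<Sum>i<n. x i ^ r) \<le> z ^ r" and x': "(\<Sum>i<n. x' i ^ r) \<le> z' ^ r"
  shows "(\<Sum>i<n. ((1 - t) * x i + t * x' i) ^ r) \<le> ((1 - t) * z + t * z') ^ r"
proof (rule power_cone_add[OF r])
  show "(\<Sum>i<n. ((1 - t) * x i) ^ r) \<le> ((1 - t) * z) ^ r"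
    using t x by (simp add: power_mult_distrib mult_left_mono flip: sum_distrib_left)
  show "(\<Sum>i<n. (t * x' i) ^ r) \<le> (t * z') ^ r"
    using t x' by (simp add: power_mult_distrib mult_left_mono flip: sum_distrib_left)
qed (use z t in auto)

text \<open>A feasible point with a maximal set \<open>I\<close> of tight constraints: moving from it inside \<open>C\<close> along the
  constraints of \<open>I\<close>, the first constraint to become violated would have to become tight.\<close>

lemma feasible_face:
  fixes l :: "nat \<Rightarrow> 'w \<Rightarrow> real" and seg :: "real \<Rightarrow> 'w \<Rightarrow> 'w \<Rightarrow> 'w"
  assumes seg: "\<And>t w w'. 0 \<le> t \<Longrightarrow> t \<le> 1 \<Longrightarrow> w \<in> C \<Longrightarrow> w' \<in> C \<Longrightarrow> seg t w w' \<in> C"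
    and aff: "\<And>i t w w'. l i (seg t w w') = (1 - t) * l i w + t * l i w'"
    and feas: "\<exists>w\<in>C. \<forall>i<m. l i w \<le> 0"
  shows "\<exists>I\<subseteq>{..<m}. (\<exists>w\<in>C. \<forall>i\<in>I. l i w = 0) \<and>
    (\<forall>w\<in>C. (\<forall>i\<in>I. l i w = 0) \<longrightarrow> (\<forall>i<m. l i w \<le> 0))"
proof -
  define tight where "tight w = {i. i < m \<and> l i w = 0}" for w
  define S where "S = tight ` {w\<in>C. \<forall>i<m. l i w \<le> 0}"
  have "finite S" by (rule finite_subset[of _ "Pow {..<m}"]) (auto simp: S_def tight_def)
  moreover have "S \<noteq> {}" using feas unfolding S_def by auto
  ultimately obtain I where I: "I \<in> S" "\<And>J. J \<in> S \<Longrightarrow> I \<subseteq> J \<Longrightarrow> I = J"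
    using finite_has_maximal[of S] by auto
  then obtain w where w: "w \<in> C" "\<And>i. i < m \<Longrightarrow> l i w \<le> 0" "I = tight w"
    unfolding S_def by auto
  have "l i w' \<le> 0" if w': "w' \<in> C" "\<forall>i\<in>I. l i w' = 0" and i: "i < m" for w' i
  proof (rule ccontr)
    assume viol: "\<not> l i w' \<le> 0"
    define V where "V = {i. i < m \<and> 0 < l i w'}"
    \<comment> \<open>The parameter at which constraint \<open>k\<close> vanishes on the segment
      from \<open>w\<close> to \<open>w'\<close>; the minimum over \<open>V\<close> marks the first
      violated constraint met.\<close>
    define \<tau> where "\<tau> k = - l k w / (l k w' - l k w)" for k
    have V: "finite V" "V \<noteq> {}" unfolding V_def using viol i by auto
    then have "Min (\<tau> ` V) \<in> \<tau> ` V" by simp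
    then obtain k where k: "k \<in> V" "\<tau> k = Min (\<tau> ` V)" by auto
    have min: "\<tau> k \<le> \<tau> i" if "i \<in> V" for i unfolding k(2) using V(1) that by simp
    have gap: "0 < l i w' - l i w" if "i \<in> V" for i using w(2) that unfolding V_def by fastforce
    have lk: "l k w \<le> 0" "0 < l k w'" "k < m" using k(1) w(2) unfolding V_def by auto
    have t: "0 \<le> \<tau> k" "\<tau> k \<le> 1" unfolding \<tau>_def using lk by (auto simp: field_simps)
    define u where "u = seg (\<tau> k) w w'"
    have lu: "l i u = (1 - \<tau> k) * l i w + \<tau> k * l i w'" for i unfolding u_def by (rule aff)
    have "l i u \<le> 0" if "i < m" for i
    proof (cases "i \<in> V")
      case True
      have "l i u = l i w + \<tau> k * (l i w' - l i w)" unfolding lu by (simp add: algebra_simps)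
      also have "\<dots> \<le> l i w + \<tau> i * (l i w' - l i w)"
        using gap[OF True] min[OF True] by simp
      also have "\<dots> = 0" unfolding \<tau>_def using gap[OF True] by simp
      finally show ?thesis .
    next
      case False
      then have "l i w' \<le> 0" using that unfolding V_def by auto
      then show ?thesis unfolding lu using t w(2)[OF that]
        by (intro add_nonpos_nonpos mult_nonneg_nonpos) auto
    qed
    moreover have "u \<in> C" unfolding u_def using t w(1) w'(1) by (intro seg)
    ultimately have "tight u \<in> S" unfolding S_def by auto
    moreover have "I \<subseteq> tight u"
      using w'(2) unfolding w(3) tight_def lu by auto
    moreover have "l k u = l k w + \<tau> k * (l k w' - l k w)" unfolding lu by (simp add: algebra_simps)
    then have "l k u = 0" unfolding \<tau>_def using gap[OF k(1)] by simp
    then have "k \<in> tight u" unfolding tight_def using lk by simp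
    \<comment> \<open>By maximality \<open>tight u\<close> equals \<open>I\<close>, so
      \<open>k\<close> would be tight at \<open>w'\<close>, where it is violated.\<close>
    ultimately have "k \<in> I" using I(2) by blast
    then show False using w'(2) lk by auto
  qed
  moreover have "I \<subseteq> {..<m}" "\<forall>i\<in>I. l i w = 0" unfolding w(3) tight_def by auto
  ultimately show ?thesis using w(1) by blast
qed

text \<open>The bound of \<open>bounded_real_zero\<close> for the polynomial that encodes a face.
  \<open>E\<close> is odd and exceeds the degree \<open>4 * r\<close>. In \<open>L\<close>, the
  power with exponent \<open>N\<close> counts integer rows of length \<open>N\<close> with entries
  between \<open>- (2 ^ \<tau>)\<close> and \<open>2 ^ \<tau>\<close>; each contributes the square
  of a polynomial with coefficient sum at most \<open>N * 2 ^ \<tau>\<close>. The last summand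
  belongs to the squared cone equation.\<close>

definition coord_bound :: "nat \<Rightarrow> nat \<Rightarrow> nat \<Rightarrow> real" where
  "coord_bound r n \<tau> = (let N = n + 2; E = 4 * r + 1;
      L = real ((2 * 2 ^ \<tau> + 1) ^ N) * (real N * 2 ^ \<tau>)\<^sup>2 + (real N)\<^sup>2
    in fact (E ^ N) * (1 + (real (4 * r) * L) ^ (N * E)) ^ (E ^ N))"

text \<open>Coordinates \<open>n\<close> and \<open>n + 1\<close> of \<open>y\<close> hold
  \<open>u\<close> and the slack \<open>s\<close>. Writing \<open>z\<close> as the square of
  \<open>u\<close> enforces \<open>0 \<le> z\<close>, the square of \<open>s\<close> turns the cone
  inequality into an equation, and a sum of squares merges all equations into \<open>Q\<close>. The
  bound on \<open>z\<close> is squared because \<open>z\<close> is a square.\<close>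

lemma bounded_point_on_face:
  fixes a :: "nat \<Rightarrow> nat \<Rightarrow> int" and g h :: "nat \<Rightarrow> int"
  assumes r: "even r" "0 < r" and I: "finite I"
    and size: "\<And>i j. i \<in> I \<Longrightarrow> j < n \<Longrightarrow> \<bar>a i j\<bar> \<le> 2 ^ \<tau>"
      "\<And>i. i \<in> I \<Longrightarrow> \<bar>g i\<bar> \<le> 2 ^ \<tau>" "\<And>i. i \<in> I \<Longrightarrow> \<bar>h i\<bar> \<le> 2 ^ \<tau>"
    and x0: "0 \<le> z0" "(\<Sum>j<n. x0 j ^ r) \<le> z0 ^ r"
      "\<And>i. i \<in> I \<Longrightarrow> (\<Sum>j<n. of_int (a i j) * x0 j) + of_int (g i) * z0 - of_int (h i) = (0::real)"
  shows "\<exists>x z. 0 \<le> z \<and> (\<Sum>j<n. x j ^ r) \<le> z ^ r \<and>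
    (\<forall>i\<in>I. (\<Sum>j<n. of_int (a i j) * x j) + of_int (g i) * z - of_int (h i) = (0::real)) \<and>
    (\<forall>j<n. \<bar>x j\<bar> \<le> coord_bound r n \<tau>) \<and> z \<le> (coord_bound r n \<tau>)\<^sup>2"
proof -
  define N where "N = n + 2"
  define E where "E = 4 * r + 1"
  define K where "K = (2 * 2 ^ \<tau> + 1 :: nat) ^ N"
  define L where "L = real K * (real N * 2 ^ \<tau>)\<^sup>2 + (real N)\<^sup>2"
  have r2: "2 \<le> r" using r by presburger
  define row where "row i = map (a i) [0..<n] @ [g i, h i]" for i
  \<comment> \<open>One representative for each distinct row of data, so that the number of
    equations is bounded independently of the size of \<open>I\<close>.\<close>
  obtain J where J: "J \<subseteq> I" "inj_on row J" "row ` I = row ` J"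
    using subset_image_inj[of "row ` I" row I] by auto
  have finJ: "finite J" using J(1) I finite_subset by blast
  have "card J = card (row ` I)" using J(2,3) by (simp add: card_image)
  also have "\<dots> \<le> card {xs. set xs \<subseteq> {- (2 ^ \<tau>)..(2::int) ^ \<tau>} \<and> length xs = N}"
  proof (intro card_mono finite_lists_length_eq)
    show "row ` I \<subseteq> {xs. set xs \<subseteq> {- (2 ^ \<tau>)..(2::int) ^ \<tau>} \<and> length xs = N}"
      using size by (auto simp: row_def N_def abs_le_iff) (fastforce simp: abs_le_iff)+
  qed simp
  also have "\<dots> = K"
    unfolding K_def by (simp add: card_lists_length_eq nat_add_distrib nat_mult_distrib nat_power_eq)
  finally have cardJ: "card J \<le> K" .
  \<comment> \<open>The exponent 1 matches the shape of \<open>mpoly_power_var\<close>.\<close>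
  define q where "q i y = (\<Sum>j<n. of_int (a i j) * y j ^ 1) + of_int (g i) * y n ^ 2 - of_int (h i)"
    for i and y :: "nat \<Rightarrow> real"
  define p where "p y = y n ^ (2 * r) - (\<Sum>j<n. y j ^ r) - y (n + 1) ^ 2" for y :: "nat \<Rightarrow> real"
  define Q where "Q y = (\<Sum>i\<in>J. q i y * q i y) + p y * p y" for y
  have "mpoly N 2 (real N * 2 ^ \<tau>) (q i)" if "i \<in> J" for i
  proof -
    have i: "i \<in> I" using that J(1) by auto
    have b: "\<bar>real_of_int c\<bar> \<le> 2 ^ \<tau>" if "\<bar>c\<bar> \<le> 2 ^ \<tau>" for c :: int
    proof -
      have "real_of_int \<bar>c\<bar> \<le> real_of_int (2 ^ \<tau>)" using that of_int_le_iff by blast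
      then show ?thesis by simp
    qed
    have "mpoly N 2 (2 ^ \<tau>) (\<lambda>y. of_int (a i j) * y j ^ 1)" if "j \<in> {..<n}" for j
      using that i by (intro mpoly_weaken[OF mpoly_cmult[OF mpoly_power_var]])
        (auto simp: N_def intro!: b size)
    then have s: "mpoly N 2 (real n * 2 ^ \<tau>) (\<lambda>y. \<Sum>j<n. of_int (a i j) * y j ^ 1)"
      using mpoly_sum[of "{..<n}"] by simp
    have "mpoly N 2 (real n * 2 ^ \<tau> + \<bar>of_int (g i)\<bar> * 1 + \<bar>of_int (h i)\<bar>) (q i)"
      unfolding q_def
      by (intro mpoly_diff mpoly_add s mpoly_cmult mpoly_power_var mpoly_const) (simp add: N_def)
    then show ?thesis
      by (rule mpoly_weaken) (use b[OF size(2)[OF i]] b[OF size(3)[OF i]] in \<open>auto simp: N_def algebra_simps\<close>)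
  qed
  then have "mpoly N (2 + 2) (real N * 2 ^ \<tau> * (real N * 2 ^ \<tau>)) (\<lambda>y. q i y * q i y)" if "i \<in> J" for i
    using that by (intro mpoly_mult)
  then have "mpoly N (2 + 2) (real (card J) * (real N * 2 ^ \<tau> * (real N * 2 ^ \<tau>))) (\<lambda>y. \<Sum>i\<in>J. q i y * q i y)"
    by (intro mpoly_sum finJ)
  then have Q1: "mpoly N (4 * r) (real K * (real N * 2 ^ \<tau>)\<^sup>2) (\<lambda>y. \<Sum>i\<in>J. q i y * q i y)"
    by (rule mpoly_weaken)
      (use r2 cardJ in \<open>auto simp: power2_eq_square intro!: mult_right_mono\<close>)
  have s: "mpoly N (2 * r) (real n * 1) (\<lambda>y. \<Sum>j<n. y j ^ r)"
  proof -
    have "mpoly N (2 * r) 1 (\<lambda>y. y j ^ r)" if "j \<in> {..<n}" for j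
      using that by (intro mpoly_weaken[OF mpoly_power_var]) (auto simp: N_def)
    then show ?thesis using mpoly_sum[of "{..<n}" N "2 * r" 1 "\<lambda>j y. y j ^ r"] by simp
  qed
  have sq: "mpoly N (2 * r) 1 (\<lambda>y. y (n + 1) ^ 2)"
    using r2 by (intro mpoly_weaken[OF mpoly_power_var]) (auto simp: N_def)
  have "mpoly N (2 * r) (1 + real n * 1 + 1) p"
    unfolding p_def by (intro mpoly_diff s sq mpoly_power_var) (simp add: N_def)
  from mpoly_mult[OF this this]
  have "mpoly N (4 * r) ((real N)\<^sup>2) (\<lambda>y. p y * p y)"
    by (rule mpoly_weaken) (auto simp: N_def power2_eq_square)
  with Q1 have Q: "mpoly N (4 * r) L Q"
    unfolding Q_def L_def by (rule mpoly_add)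
  have Q0: "0 \<le> Q y" for y unfolding Q_def by (intro add_nonneg_nonneg sum_nonneg) auto
  \<comment> \<open>The given point, with \<open>u\<close> and \<open>s\<close> recovered as square
    roots, is a zero of \<open>Q\<close>.\<close>
  define y0 where "y0 j = (if j < n then x0 j else if j = n then sqrt z0
    else sqrt (z0 ^ r - (\<Sum>j<n. x0 j ^ r)))" for j
  have zn: "y0 n ^ 2 = z0" unfolding y0_def using x0(1) by simp
  have yx: "(\<Sum>j<n. f j (y0 j)) = (\<Sum>j<n. f j (x0 j))" for f :: "nat \<Rightarrow> real \<Rightarrow> real"
    by (rule sum.cong) (auto simp: y0_def)
  have "y0 n ^ (2 * r) = z0 ^ r" by (simp add: power_mult zn)
  moreover have "y0 (n + 1) ^ 2 = z0 ^ r - (\<Sum>j<n. x0 j ^ r)" unfolding y0_def using x0(2) by simp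
  ultimately have "p y0 = 0"
    unfolding p_def using yx[of "\<lambda>_ t. t ^ r"] by simp
  moreover have "q i y0 = 0" if "i \<in> J" for i
    unfolding q_def zn using yx[of "\<lambda>j t. of_int (a i j) * t ^ 1"] x0(3)[of i] that J(1) by auto
  ultimately have "Q y0 = 0" unfolding Q_def by simp
  moreover have "1 \<le> real (4 * r) * L"
  proof -
    have "1 * 1 \<le> real (4 * r) * L"
      unfolding L_def using r2 by (intro mult_mono add_increasing) (auto simp: N_def)
    then show ?thesis by simp
  qed
  ultimately obtain y where y: "Q y = 0"
    "\<And>j. j < N \<Longrightarrow> \<bar>y j\<bar> \<le> fact (E ^ N) * (1 + (real (4 * r) * L) ^ (N * E)) ^ (E ^ N)"
    using bounded_real_zero[OF Q Q0, of y0 E] unfolding E_def by auto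
  have cb: "fact (E ^ N) * (1 + (real (4 * r) * L) ^ (N * E)) ^ (E ^ N) = coord_bound r n \<tau>"
    unfolding coord_bound_def Let_def L_def K_def E_def N_def by simp
  have yb: "\<bar>y j\<bar> \<le> coord_bound r n \<tau>" if "j < n + 2" for j
    unfolding cb[symmetric] using that by (intro y(2)) (simp add: N_def)
  have "(\<Sum>i\<in>J. q i y * q i y) = 0" "p y * p y = 0"
    using y(1) sum_nonneg[of J "\<lambda>i. q i y * q i y"] zero_le_square[of "p y"]
    unfolding Q_def by (simp_all add: add_nonneg_eq_0_iff del: mult_eq_0_iff)
  then have qy: "q i y = 0" if "i \<in> J" for i
    using that finJ by (simp add: sum_nonneg_eq_0_iff)
  have py: "p y = 0" using \<open>p y * p y = 0\<close> by simp
  have "(\<Sum>j<n. of_int (a i j) * y j) + of_int (g i) * (y n)\<^sup>2 - of_int (h i) = 0" if "i \<in> I" for i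
  proof -
    \<comment> \<open>An equation outside \<open>J\<close> coincides with that of its
      representative.\<close>
    have "row i \<in> row ` J" using that unfolding J(3)[symmetric] by (rule imageI)
    then obtain k where k: "k \<in> J" "row i = row k" by (elim imageE)
    then have "a i j = a k j" if "j < n" for j using that by (simp add: row_def)
    moreover have "g i = g k" "h i = h k" using k(2) by (auto simp: row_def)
    ultimately show ?thesis using qy[OF k(1)] by (simp add: q_def)
  qed
  moreover have "(\<Sum>j<n. y j ^ r) \<le> ((y n)\<^sup>2) ^ r"
    using py zero_le_power2[of "y (n + 1)"] unfolding p_def power_mult[symmetric] by linarith
  moreover have "(y n)\<^sup>2 \<le> (coord_bound r n \<tau>)\<^sup>2"
    using power_mono[OF yb[of n], of 2] by simp
  ultimately show ?thesis
    using yb by (intro exI[of _ y] exI[of _ "(y n)\<^sup>2"]) auto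
qed

lemma bounded_feasible_point:
  fixes a :: "nat \<Rightarrow> nat \<Rightarrow> int" and g h :: "nat \<Rightarrow> int"
  assumes r: "even r" "0 < r"
    and size: "\<And>i j. i < m \<Longrightarrow> j < n \<Longrightarrow> \<bar>a i j\<bar> \<le> 2 ^ \<tau>"
      "\<And>i. i < m \<Longrightarrow> \<bar>g i\<bar> \<le> 2 ^ \<tau>" "\<And>i. i < m \<Longrightarrow> \<bar>h i\<bar> \<le> 2 ^ \<tau>"
    and x0: "0 \<le> z0" "(\<Sum>j<n. x0 j ^ r) \<le> z0 ^ r"
      "\<And>i. i < m \<Longrightarrow> (\<Sum>j<n. of_int (a i j) * x0 j) + of_int (g i) * z0 \<le> (of_int (h i) :: real)"
  shows "\<exists>x z. 0 \<le> z \<and> (\<Sum>j<n. x j ^ r) \<le> z ^ r \<and>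
    (\<forall>i<m. (\<Sum>j<n. of_int (a i j) * x j) + of_int (g i) * z \<le> (of_int (h i) :: real)) \<and>
    (\<forall>j<n. \<bar>x j\<bar> \<le> coord_bound r n \<tau>) \<and> z \<le> (coord_bound r n \<tau>)\<^sup>2"
proof -
  define C where "C = {(x :: nat \<Rightarrow> real, z). 0 \<le> z \<and> (\<Sum>j<n. x j ^ r) \<le> z ^ r}"
  define l where "l i w = (\<Sum>j<n. of_int (a i j) * fst w j) + of_int (g i) * snd w - of_int (h i)"
    for i and w :: "(nat \<Rightarrow> real) \<times> real"
  define seg where "seg t w w' = (\<lambda>j. (1 - t) * fst w j + t * fst w' j, (1 - t) * snd w + t * snd w')"
    for t and w w' :: "(nat \<Rightarrow> real) \<times> real"
  have "\<exists>I\<subseteq>{..<m}. (\<exists>w\<in>C. \<forall>i\<in>I. l i w = 0) \<and>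
    (\<forall>w\<in>C. (\<forall>i\<in>I. l i w = 0) \<longrightarrow> (\<forall>i<m. l i w \<le> 0))"
  proof (rule feasible_face[where seg = seg])
    fix t :: real and w w' assume "0 \<le> t" "t \<le> 1" "w \<in> C" "w' \<in> C"
    then show "seg t w w' \<in> C"
      unfolding C_def seg_def by (auto intro!: power_cone_convex r add_nonneg_nonneg)
  next
    fix i w w' and t :: real
    show "l i (seg t w w') = (1 - t) * l i w + t * l i w'"
      unfolding l_def seg_def by (simp add: algebra_simps sum.distrib sum_distrib_left sum_subtractf)
  next
    show "\<exists>w\<in>C. \<forall>i<m. l i w \<le> 0"
      using x0 unfolding C_def l_def by (intro bexI[of _ "(x0, z0)"]) auto
  qed
  then obtain I w where I: "I \<subseteq> {..<m}" "w \<in> C" "\<And>i. i \<in> I \<Longrightarrow> l i w = 0"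
    "\<And>w. w \<in> C \<Longrightarrow> \<forall>i\<in>I. l i w = 0 \<Longrightarrow> \<forall>i<m. l i w \<le> 0" by blast
  have "\<exists>x z. 0 \<le> z \<and> (\<Sum>j<n. x j ^ r) \<le> z ^ r \<and>
    (\<forall>i\<in>I. (\<Sum>j<n. of_int (a i j) * x j) + of_int (g i) * z - of_int (h i) = (0::real)) \<and>
    (\<forall>j<n. \<bar>x j\<bar> \<le> coord_bound r n \<tau>) \<and> z \<le> (coord_bound r n \<tau>)\<^sup>2"
  proof (rule bounded_point_on_face[OF r])
    show "finite I" using I(1) finite_subset by blast
    show "0 \<le> snd w" "(\<Sum>j<n. fst w j ^ r) \<le> snd w ^ r" using I(2) unfolding C_def by auto
  qed (use I(1,3) size in \<open>auto simp: l_def\<close>)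
  then obtain x z where xz: "0 \<le> z" "(\<Sum>j<n. x j ^ r) \<le> z ^ r"
    "\<forall>i\<in>I. l i (x, z) = 0" "\<forall>j<n. \<bar>x j\<bar> \<le> coord_bound r n \<tau>" "z \<le> (coord_bound r n \<tau>)\<^sup>2"
    unfolding l_def by auto
  have "\<forall>i<m. l i (x, z) \<le> 0" using I(4)[of "(x, z)"] xz unfolding C_def by auto
  then show ?thesis using xz unfolding l_def by (intro exI[of _ x] exI[of _ z]) auto
qed

section \<open>Size of the bound\<close>

lemma coord_bound_ge_1: "1 \<le> coord_bound r n \<tau>"
  unfolding coord_bound_def Let_def
  by (rule order_trans[OF _ mult_mono[of 1 _ 1]]) (auto simp: fact_ge_1)

text \<open>Every factor is bounded by a power of two, using \<open>k \<le> 2 ^ k\<close>, so that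
  only exponents need comparing. The computation stays in the naturals until the end.\<close>

lemma coord_bound_le:
  assumes "1 \<le> \<tau>" "2 \<le> r" "N = n + 2" "E = 4 * r + 1"
  shows "coord_bound r n \<tau> \<le> 2 ^ (11 * \<tau> * E ^ N * (N * E)\<^sup>2)"
proof -
  define K where "K = (2 * 2 ^ \<tau> + 1 :: nat) ^ N"
  define L where "L = K * (N * 2 ^ \<tau>)\<^sup>2 + N\<^sup>2"
  define A where "A = 4 * r * L"
  define D where "D = E ^ N"
  define X where "X = N * E"
  have pow: "k \<le> 2 ^ k" for k :: nat using less_exp[of k] by simp
  have N: "2 \<le> N" "N \<noteq> 0" and E: "9 \<le> E" using assms by auto
  have "2 * 2 ^ \<tau> + 1 \<le> (2::nat) ^ (\<tau> + 2)" by simp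
  then have K: "K \<le> 2 ^ ((\<tau> + 2) * N)"
    unfolding K_def by (simp only: power_mult power_mono)
  have N2: "N\<^sup>2 \<le> 2 ^ (2 * N)"
    using power_mono[OF pow[of N], of 2] by (simp add: power_mult mult.commute flip: power_mult)
  have "(N * 2 ^ \<tau>)\<^sup>2 \<le> 2 ^ (2 * N) * 2 ^ (2 * \<tau>)"
    using N2 by (simp add: power_mult_distrib mult.commute flip: power_mult)
  with K have "L \<le> 2 ^ ((\<tau> + 2) * N) * (2 ^ (2 * N) * 2 ^ (2 * \<tau>)) + 2 ^ (2 * N)"
    unfolding L_def using N2 by (intro add_mono mult_mono) auto
  also have "\<dots> = 2 ^ ((\<tau> + 2) * N + 2 * N + 2 * \<tau>) + 2 ^ (2 * N)"
    by (simp only: power_add mult.assoc)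
  also have "\<dots> \<le> 2 ^ ((\<tau> + 2) * N + 2 * N + 2 * \<tau>) + 2 ^ ((\<tau> + 2) * N + 2 * N + 2 * \<tau>)"
    by (intro add_mono power_increasing) auto
  also have "\<dots> = 2 ^ Suc ((\<tau> + 2) * N + 2 * N + 2 * \<tau>)" by simp
  also have "\<dots> \<le> 2 ^ (8 * (\<tau> * N))"
  proof (rule power_increasing)
    \<comment> \<open>The exponent is \<open>\<tau> * N + 4 * N + 2 * \<tau> + 1\<close>, which
      these estimates bound by \<open>7 * (\<tau> * N)\<close>.\<close>
    have "N \<le> \<tau> * N" "\<tau> * 2 \<le> \<tau> * N" "1 \<le> \<tau> * N" using assms(1) N by (auto simp: Suc_le_eq)
    moreover have "(\<tau> + 2) * N = \<tau> * N + 2 * N" by (rule distrib_right)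
    ultimately show "Suc ((\<tau> + 2) * N + 2 * N + 2 * \<tau>) \<le> 8 * (\<tau> * N)" by linarith
  qed simp
  finally have L: "L \<le> 2 ^ (8 * (\<tau> * N))" .
  have "4 * r \<le> 2 ^ E" using pow[of E] assms(4) by linarith
  from this L have "A \<le> 2 ^ E * 2 ^ (8 * (\<tau> * N))" unfolding A_def by (rule mult_mono) auto
  also have "\<dots> \<le> 2 ^ (9 * (\<tau> * X))" unfolding power_add[symmetric]
  proof (rule power_increasing)
    have "1 * 1 * E \<le> \<tau> * N * E" "\<tau> * N * 1 \<le> \<tau> * N * E"
      using assms(1) N E by (intro mult_mono; simp)+
    then show "E + 8 * (\<tau> * N) \<le> 9 * (\<tau> * X)" unfolding X_def mult.assoc by linarith
  qed simp
  finally have "A \<le> 2 ^ (9 * (\<tau> * X))" .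
  then have "A ^ X \<le> (2 ^ (9 * (\<tau> * X))) ^ X" by (rule power_mono) simp
  then have "A ^ X \<le> 2 ^ (9 * (\<tau> * X) * X)" by (simp only: power_mult)
  then have "1 + A ^ X \<le> 2 ^ (9 * (\<tau> * X) * X) + 2 ^ (9 * (\<tau> * X) * X)"
    by (intro add_mono) simp_all
  also have "\<dots> = 2 ^ Suc (9 * (\<tau> * X) * X)" by simp
  also have "\<dots> \<le> 2 ^ (10 * (\<tau> * X\<^sup>2))"
  proof (rule power_increasing)
    have "1 \<le> \<tau> * X\<^sup>2" using assms(1) N E unfolding X_def by (simp add: Suc_le_eq)
    then show "Suc (9 * (\<tau> * X) * X) \<le> 10 * (\<tau> * X\<^sup>2)" unfolding power2_eq_square mult.assoc by linarith
  qed simp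
  finally have base: "1 + A ^ X \<le> 2 ^ (10 * (\<tau> * X\<^sup>2))" .
  have "D \<le> (2 ^ E) ^ N" unfolding D_def by (intro power_mono pow) simp
  then have "D \<le> 2 ^ X" unfolding X_def by (simp add: mult.commute flip: power_mult)
  also have "\<dots> \<le> 2 ^ (\<tau> * X\<^sup>2)"
    using assms(1) by (intro power_increasing) (auto simp: power2_eq_square)
  finally have "D ^ D \<le> (2 ^ (\<tau> * X\<^sup>2)) ^ D" by (rule power_mono) simp
  moreover have "fact D \<le> D ^ D" using fact_le_power[of D, where ?'a = nat] by simp
  ultimately have f: "fact D \<le> ((2::nat) ^ (\<tau> * X\<^sup>2)) ^ D" by linarith
  \<comment> \<open>Of the eleven multiples of \<open>\<tau> * D * X\<^sup>2\<close> in the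
    exponent, one comes from the factorial and ten from the power.\<close>
  have "fact D * (1 + A ^ X) ^ D \<le> ((2::nat) ^ (\<tau> * X\<^sup>2)) ^ D * (2 ^ (10 * (\<tau> * X\<^sup>2))) ^ D"
    by (intro mult_mono f power_mono base) auto
  also have "\<dots> = 2 ^ (11 * \<tau> * D * X\<^sup>2)"
    by (simp only: power_mult[symmetric] power_add[symmetric]) (simp add: algebra_simps)
  finally have "real (fact D * (1 + A ^ X) ^ D) \<le> real (2 ^ (11 * \<tau> * D * X\<^sup>2))"
    by (simp only: of_nat_le_iff)
  moreover have "coord_bound r n \<tau> = real (fact D * (1 + A ^ X) ^ D)"
    unfolding coord_bound_def Let_def assms(3,4)[symmetric] D_def A_def X_def L_def K_def
    by (simp only: of_nat_add of_nat_mult of_nat_power of_nat_1 of_nat_numeral of_nat_fact)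
  ultimately show ?thesis unfolding D_def X_def by simp
qed

text \<open>The square accounts for \<open>z\<close>, and \<open>n + 1\<close> for passing from
  coordinates to the Euclidean norm. These give \<open>22 * X\<close> and \<open>X\<close> in the
  exponent. Since \<open>k \<ge> 1\<close>, passing from \<open>r\<close> to \<open>k * r\<close>
  only enlarges the base.\<close>

lemma norm_bound_le:
  assumes "1 \<le> \<tau>" "2 \<le> r" "1 \<le> k"
  shows "real (n + 1) * (coord_bound r n \<tau>)\<^sup>2 \<le> 2 powr (real \<tau> * real (k * r) powr real (8 * n + 32))"
proof -
  define N where "N = n + 2"
  define E where "E = 4 * r + 1"
  define X where "X = \<tau> * E ^ N * (N * E)\<^sup>2"
  have E: "9 \<le> E" using assms(2) unfolding E_def by simp
  have "(coord_bound r n \<tau>)\<^sup>2 \<le> (2 ^ (11 * X))\<^sup>2"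
    using coord_bound_le[OF assms(1,2) N_def E_def] coord_bound_ge_1[of r n \<tau>]
    unfolding X_def by (intro power_mono) (auto simp: mult.assoc)
  also have "\<dots> = 2 ^ (22 * X)" by (simp flip: power_mult)
  finally have c: "(coord_bound r n \<tau>)\<^sup>2 \<le> 2 ^ (22 * X)" .
  have "n + 1 \<le> N * 1 * 1" unfolding N_def by simp
  also have "\<dots> \<le> N * E * (\<tau> * E ^ N * (N * E))"
    using assms(1) E by (intro mult_mono) (auto simp: N_def Suc_le_eq)
  also have "\<dots> = X" unfolding X_def by (simp add: power2_eq_square)
  also have "\<dots> \<le> 2 ^ X" using less_exp[of X] by simp
  finally have "real (n + 1) \<le> 2 ^ X" by (metis of_nat_le_iff of_nat_numeral of_nat_power)
  then have "real (n + 1) * (coord_bound r n \<tau>)\<^sup>2 \<le> 2 ^ X * 2 ^ (22 * X)"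
    by (intro mult_mono c) auto
  also have "\<dots> = 2 ^ (23 * X)" by (simp flip: power_add)
  also have "\<dots> \<le> 2 ^ (\<tau> * (k * r) ^ (8 * n + 32))"
  proof (rule power_increasing)
    have "N\<^sup>2 \<le> (2 ^ N)\<^sup>2" using less_exp[of N] by (intro power_mono) auto
    also have "\<dots> = 4 ^ N" by (simp add: power2_eq_square flip: power_mult_distrib)
    also have "\<dots> \<le> E ^ N" using E by (intro power_mono) auto
    finally have N2: "N\<^sup>2 \<le> E ^ N" .
    \<comment> \<open>Exponents of \<open>E\<close>: 2 absorbs the constant 23, \<open>N\<close> is
      present already, and \<open>N + 2\<close> comes from \<open>(N * E)\<^sup>2\<close>.\<close>
    have "23 \<le> E\<^sup>2" using power_mono[OF E, of 2] by simp
    then have "23 * X \<le> E\<^sup>2 * (\<tau> * E ^ N * (E ^ N * E\<^sup>2))"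
      unfolding X_def power_mult_distrib by (intro mult_mono N2) auto
    also have "\<dots> = \<tau> * E ^ (2 + N + (N + 2))" by (simp only: power_add mult_ac)
    also have "2 + N + (N + 2) = 2 * n + 8" unfolding N_def by simp
    finally have X: "23 * X \<le> \<tau> * E ^ (2 * n + 8)" .
    \<comment> \<open>As \<open>4 * r + 1 \<le> 8 * r \<le> r ^ 4\<close>, passing from
      \<open>E\<close> to \<open>r\<close> multiplies the exponent \<open>2 * n + 8\<close> by
      four.\<close>
    have "E \<le> r * (2 * 2 * 2)" using assms(2) unfolding E_def by linarith
    also have "\<dots> \<le> r * (r * r * r)" using assms(2) by (intro mult_mono) auto
    also have "\<dots> = r ^ 4" by (simp add: eval_nat_numeral)
    finally have "E ^ (2 * n + 8) \<le> (r ^ 4) ^ (2 * n + 8)" by (intro power_mono) auto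
    also have "\<dots> = r ^ (8 * n + 32)" by (simp flip: power_mult)
    also have "\<dots> \<le> (k * r) ^ (8 * n + 32)" using assms(3) by (intro power_mono) auto
    finally have "\<tau> * E ^ (2 * n + 8) \<le> \<tau> * (k * r) ^ (8 * n + 32)" by simp
    with X show "23 * X \<le> \<tau> * (k * r) ^ (8 * n + 32)" by linarith
  qed simp
  also have "\<dots> = 2 powr (real \<tau> * real (k * r) powr real (8 * n + 32))"
  proof -
    have "0 < real (k * r)" using assms by simp
    then show ?thesis by (subst powr_realpow) (simp_all flip: powr_realpow)
  qed
  finally show ?thesis .
qed

section \<open>Polynomial form of the cone and of the data, and the final estimate\<close>

lemma p_norm_even_le_iff:
  assumes r: "even r" "0 < r"
  shows "p_norm (real r) x \<le> z \<longleftrightarrow> 0 \<le> z \<and> (\<Sum>i<dim_vec x. (x $ i) ^ r) \<le> z ^ r"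
proof -
  define S where "S = (\<Sum>i<dim_vec x. (x $ i) ^ r)"
  have S: "0 \<le> S" unfolding S_def using r(1) by (intro sum_nonneg zero_le_even_power)
  \<comment> \<open>Evenness of \<open>r\<close> removes the absolute value and makes the cone
    condition polynomial.\<close>
  have "\<bar>t\<bar> powr real r = t ^ r" for t :: real
  proof (cases "t = 0")
    case False
    then show ?thesis using r(1) by (simp add: powr_realpow power_even_abs)
  qed (use r in simp)
  then have "p_norm (real r) x = root r S"
    unfolding p_norm_def S_def[symmetric] using S r(2) by (simp add: root_powr_inverse S_def)
  moreover have "root r S \<le> z \<longleftrightarrow> 0 \<le> z \<and> S \<le> z ^ r"
  proof
    assume le: "root r S \<le> z"
    have 0: "0 \<le> root r S" using S r(2) by simp
    then have "root r S ^ r \<le> z ^ r" using le by (intro power_mono)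
    then show "0 \<le> z \<and> S \<le> z ^ r" using order_trans[OF 0 le] S r(2) by (simp add: real_root_pow_pos2)
  next
    assume "0 \<le> z \<and> S \<le> z ^ r"
    then show "root r S \<le> z" using r(2)
      by (metis real_root_le_iff real_root_power_cancel)
  qed
  ultimately show ?thesis unfolding S_def by simp
qed

text \<open>The factor \<open>dim_vec x\<close> in place of its square root keeps the estimate free
  of roots.\<close>

lemma p_norm_2_le:
  assumes "0 \<le> b" "\<And>i. i < dim_vec x \<Longrightarrow> \<bar>x $ i\<bar> \<le> b"
  shows "p_norm 2 x \<le> real (dim_vec x) * b"
proof -
  have "(\<Sum>i<dim_vec x. (x $ i)\<^sup>2) \<le> (\<Sum>i<dim_vec x. b\<^sup>2)"
    using assms by (intro sum_mono) (simp add: abs_le_square_iff[symmetric])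
  also have "\<dots> = real (dim_vec x) * b\<^sup>2" by simp
  also have "\<dots> \<le> (real (dim_vec x))\<^sup>2 * b\<^sup>2"
    by (intro mult_right_mono) (simp_all add: power2_eq_square flip: of_nat_mult)
  finally show ?thesis
    using p_norm_even_le_iff[of 2 x "real (dim_vec x) * b"] assms(1) by (simp add: power_mult_distrib)
qed

lemma feasible_solution_vec_iff:
  assumes "even r" "0 < r" and "F \<in> carrier_mat m n" "G \<in> carrier_vec m" "H \<in> carrier_vec m"
  shows "feasible_solution (real r) n F G H (vec n x, z) \<longleftrightarrow>
    0 \<le> z \<and> (\<Sum>j<n. x j ^ r) \<le> z ^ r \<and>
    (\<forall>i<m. (\<Sum>j<n. of_int (F $$ (i, j)) * x j) + of_int (G $ i) * z \<le> of_int (H $ i))"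
proof -
  have "map_mat real_of_int F *\<^sub>v vec n x + z \<cdot>\<^sub>v map_vec real_of_int G \<le> map_vec real_of_int H \<longleftrightarrow>
    (\<forall>i<m. (\<Sum>j<n. of_int (F $$ (i, j)) * x j) + of_int (G $ i) * z \<le> of_int (H $ i))"
    using carrier_matD[OF assms(3)] carrier_vecD[OF assms(4)] carrier_vecD[OF assms(5)]
    by (simp add: less_eq_vec_def scalar_prod_def atLeast0LessThan mult.commute)
  then show ?thesis
    unfolding feasible_solution_def p_cone_def by (simp add: p_norm_even_le_iff[OF assms(1,2)])
qed

lemma bit_size_le_imp_abs_le:
  assumes "bit_size b \<le> \<tau>"
  shows "\<bar>b\<bar> \<le> 2 ^ \<tau>"
proof (cases "b = 0")
  case False
  then have "0 \<le> log 2 \<bar>real_of_int b\<bar>" by (simp flip: of_int_abs)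
  then have "log 2 \<bar>real_of_int b\<bar> \<le> real \<tau>"
    using assms False unfolding bit_size_def by simp linarith
  then have "\<bar>real_of_int b\<bar> \<le> 2 ^ \<tau>"
    using False by (simp add: log_le_iff powr_realpow)
  then have "real_of_int \<bar>b\<bar> \<le> real_of_int (2 ^ \<tau>)" by simp
  then show ?thesis by (simp only: of_int_le_iff)
qed simp

theorem lemma3p3:
  shows "\<exists>(R :: nat \<Rightarrow> nat \<Rightarrow> nat \<Rightarrow> nat \<Rightarrow> real) (e :: nat \<Rightarrow> real).
    (\<forall>k. e k > 0) \<and> e \<in> O(\<lambda>k. real k) \<and>
    (\<forall>r n m \<tau>. even r \<and> r > 0 \<and> n \<ge> 2 \<and> m \<ge> 1 \<longrightarrow>
       R r n m \<tau> > 0 \<and>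
       log 2 (R r n m \<tau>) = real \<tau> * real (min m n * r) powr e n \<and>
       (\<forall>F G H. F \<in> carrier_mat m n \<and> G \<in> carrier_vec m \<and> H \<in> carrier_vec m \<and>
          bit_size_le \<tau> F G H \<and> feasible (real r) n F G H \<longrightarrow>
          (\<exists>x z. feasible_solution (real r) n F G H (x, z) \<and>
             p_norm 2 (x @\<^sub>v vec 1 (\<lambda>_. z)) \<le> R r n m \<tau>)))"
proof (rule exI[of _ "\<lambda>r n m \<tau>. 2 powr (real \<tau> * real (min m n * r) powr real (8 * n + 32))"],
    rule exI[of _ "\<lambda>k. real (8 * k + 32)"], intro conjI allI impI)
  \<comment> \<open>The witnesses are read off from \<open>norm_bound_le\<close> with
    \<open>k = min m n\<close>.\<close>
  let ?e = "\<lambda>k. real (8 * k + 32)"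
  let ?R = "\<lambda>r n m \<tau>. 2 powr (real \<tau> * real (min m n * r) powr ?e n)"
  show "?e k > 0" for k by simp
  show "?e \<in> O(\<lambda>k. real k)"
    by (rule bigoI[of _ 40], rule eventually_mono[OF eventually_ge_at_top[of 1]]) auto
  fix r n m \<tau> :: nat
  assume hyp: "even r \<and> r > 0 \<and> n \<ge> 2 \<and> m \<ge> 1"
  show "?R r n m \<tau> > 0" "log 2 (?R r n m \<tau>) = real \<tau> * real (min m n * r) powr ?e n" by simp_all
  fix F :: "int mat" and G H :: "int vec"
  assume data: "F \<in> carrier_mat m n \<and> G \<in> carrier_vec m \<and> H \<in> carrier_vec m \<and>
    bit_size_le \<tau> F G H \<and> feasible (real r) n F G H"
  have r: "even r" "0 < r" "2 \<le> r" using hyp by (simp, simp, presburger)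
  have FGH: "F \<in> carrier_mat m n" "G \<in> carrier_vec m" "H \<in> carrier_vec m" using data by auto
  note iff = feasible_solution_vec_iff[OF r(1,2) FGH]
  have size: "\<bar>F $$ (i, j)\<bar> \<le> 2 ^ \<tau>" "\<bar>G $ i\<bar> \<le> 2 ^ \<tau>" "\<bar>H $ i\<bar> \<le> 2 ^ \<tau>"
    if "i < m" "j < n" for i j
    using data that unfolding bit_size_le_def
    by (auto intro!: bit_size_le_imp_abs_le elements_matI)
  \<comment> \<open>Every bit size is at least 1, and \<open>m \<ge> 1\<close> provides an
    entry.\<close>
  have "bit_size (G $ 0) \<le> \<tau>" using data hyp unfolding bit_size_le_def by auto
  then have \<tau>: "1 \<le> \<tau>" unfolding bit_size_def by (auto split: if_splits)
  obtain x0 z0 where sol: "feasible_solution (real r) n F G H (x0, z0)"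
    using data unfolding feasible_def by auto
  then have "x0 \<in> carrier_vec n" unfolding feasible_solution_def p_cone_def by auto
  then have "x0 = vec n (\<lambda>j. x0 $ j)" by auto
  with sol have "feasible_solution (real r) n F G H (vec n (\<lambda>j. x0 $ j), z0)" by simp
  then have x0: "0 \<le> z0" "(\<Sum>j<n. (x0 $ j) ^ r) \<le> z0 ^ r"
    "\<And>i. i < m \<Longrightarrow> (\<Sum>j<n. of_int (F $$ (i, j)) * x0 $ j) + of_int (G $ i) * z0 \<le> of_int (H $ i)"
    unfolding iff by auto
  \<comment> \<open>The index 0 discharges the premise on \<open>j\<close> in the size bounds for
    \<open>G\<close> and \<open>H\<close>.\<close>
  obtain x z where xz: "0 \<le> z" "(\<Sum>j<n. x j ^ r) \<le> z ^ r"
    "\<forall>i<m. (\<Sum>j<n. of_int (F $$ (i, j)) * x j) + of_int (G $ i) * z \<le> (of_int (H $ i) :: real)"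
    "\<forall>j<n. \<bar>x j\<bar> \<le> coord_bound r n \<tau>" "z \<le> (coord_bound r n \<tau>)\<^sup>2"
    using bounded_feasible_point[OF r(1,2), of m n "\<lambda>i j. F $$ (i, j)" \<tau> "\<lambda>i. G $ i" "\<lambda>i. H $ i" z0 "\<lambda>j. x0 $ j"]
      size[of _ 0] size hyp x0 by auto
  \<comment> \<open>This gives one common bound for the coordinates of \<open>x\<close> and for
    \<open>z\<close>.\<close>
  have cb: "coord_bound r n \<tau> \<le> (coord_bound r n \<tau>)\<^sup>2"
    using coord_bound_ge_1 by (simp add: self_le_power)
  let ?v = "vec n x @\<^sub>v vec 1 (\<lambda>_. z)"
  have "\<bar>?v $ i\<bar> \<le> (coord_bound r n \<tau>)\<^sup>2" if "i < dim_vec ?v" for i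
    using that xz cb by (cases "i < n") (auto intro: order_trans)
  then have "p_norm 2 ?v \<le> real (n + 1) * (coord_bound r n \<tau>)\<^sup>2"
    using p_norm_2_le[of "(coord_bound r n \<tau>)\<^sup>2" ?v] by simp
  also have "\<dots> \<le> ?R r n m \<tau>"
    using hyp by (intro norm_bound_le \<tau> r(3)) auto
  finally have "p_norm 2 ?v \<le> ?R r n m \<tau>" .
  moreover have "feasible_solution (real r) n F G H (vec n x, z)" unfolding iff using xz by auto
  ultimately show "\<exists>x z. feasible_solution (real r) n F G H (x, z) \<and>
    p_norm 2 (x @\<^sub>v vec 1 (\<lambda>_. z)) \<le> ?R r n m \<tau>" by blast
qed

end
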